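(* Let $n\geq 3$, $\alpha\in(0,n)$, $\sigma_1,\sigma_2\in[0,\alpha)$, and suppose $q\geq p>1$ and $\sigma_1\geq\sigma_2$, and that $q_0+p_0\leq n-\alpha$. If $u,v$ are positive integrable solutions of $$u(x)=\int_{\mathbb{R}^n}\frac{v(y)^q}{|x-y|^{n-\alpha}|y|^{\sigma_1}}\,dy,\qquad v(x)=\int_{\mathbb{R}^n}\frac{u(y)^p}{|x-y|^{n-\alpha}|y|^{\sigma_2}}\,dy,\qquad x\in\mathbb{R}^n,$$ then $(u,v)\in L^r(\mathbb{R}^n)\times L^s(\mathbb{R}^n)$ for every pair $(r,s)$ with $$\frac1r\in\Big(0,\frac{n-\alpha}{n}\Big)\quad\text{and}\quad\frac1s\in\Big(0,\min\Big\{\frac{n-\alpha}{n},\frac{p(n-\alpha)-(\alpha-\sigma_2)}{n}\Big\}\Big).$$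
   Context: Define $$p_0=\frac{\alpha(1+p)-(\sigma_2+\sigma_1p)}{pq-1},\qquad q_0=\frac{\alpha(1+q)-(\sigma_1+\sigma_2q)}{pq-1},\qquad r_0=\frac{n}{q_0},\qquad s_0=\frac{n}{p_0}.$$ A positive solution $u,v$ is integrable if $u\in L^{r_0}(\mathbb{R}^n)$ and $v\in L^{s_0}(\mathbb{R}^n)$. The condition $q_0+p_0\leq n-\alpha$ is equivalent to $\frac{n-\sigma_1}{1+q}+\frac{n-\sigma_2}{1+p}\leq n-\alpha$. *)

theory Defs
  imports "HOL-Analysis.Analysis"
begin

definition in_Lp :: "real \<Rightarrow> (('a::euclidean_space) \<Rightarrow> real) \<Rightarrow> bool" where
  "in_Lp r f \<longleftrightarrow> f \<in> borel_measurable lborel \<and> integrable lborel (\<lambda>x. \<bar>f x\<bar> powr r)"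

definition p0 :: "real \<Rightarrow> real \<Rightarrow> real \<Rightarrow> real \<Rightarrow> real \<Rightarrow> real" where
  "p0 \<alpha> \<sigma>1 \<sigma>2 p q = (\<alpha> * (1 + p) - (\<sigma>2 + \<sigma>1 * p)) / (p * q - 1)"

definition q0 :: "real \<Rightarrow> real \<Rightarrow> real \<Rightarrow> real \<Rightarrow> real \<Rightarrow> real" where
  "q0 \<alpha> \<sigma>1 \<sigma>2 p q = (\<alpha> * (1 + q) - (\<sigma>1 + \<sigma>2 * q)) / (p * q - 1)"

definition wpot :: "real \<Rightarrow> real \<Rightarrow> ('a::euclidean_space \<Rightarrow> real) \<Rightarrow> 'a \<Rightarrow> ennreal" where
  "wpot \<alpha> \<sigma> f x = (\<integral>\<^sup>+ y. ennreal (f y / (norm (x - y) powr (real DIM('a) - \<alpha>) * norm y powr \<sigma>)) \<partial>lborel)"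

end

theory Submission
  imports Defs
begin

text \<open>The system is treated in weak \<open>L\<^sup>p\<close> spaces, where the singular weight \<open>|y|\<close> to the power
  \<open>-\<sigma>\<close> is just one more factor in \<open>L\<close> to the weak \<open>n/\<sigma>\<close>; the Stein-Weiss inequality then
  reduces to the weak Hoelder and weak Young inequalities.
  Freeze the coefficients \<open>v\<close> to the power \<open>q-1\<close> and \<open>u\<close> to the power \<open>p-1\<close>. Keeping them only where
  \<open>|x|\<close> or the function itself is large makes the resulting linear system a contraction for all exponents on the line \<open>1/r - 1/s = (q\<^sub>0 - p\<^sub>0)/n\<close>, up to an error which is a potential of a
  bounded function with compact support. Regularity lifting gives weak bounds on the whole line, and one
  further application of the integral equations extends them to the claimed ranges. As these ranges
  are open, interpolating two weak bounds gives the strong ones.\<close>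

section \<open>Weak Lebesgue spaces\<close>

text \<open>The parameter \<open>a\<close> is the reciprocal of the Lebesgue exponent, so that products add exponents and
  \<open>a = 0\<close> means essentially bounded.\<close>

definition weak_Lp :: "real \<Rightarrow> real \<Rightarrow> ('a::euclidean_space \<Rightarrow> ennreal) \<Rightarrow> bool" where
  "weak_Lp a C f \<longleftrightarrow> f \<in> borel_measurable borel \<and>
     (\<forall>m>0. emeasure lborel {x. ennreal (C * m powr - a) < f x} \<le> ennreal m)"

lemma weak_Lp_measurable [measurable_dest]: "weak_Lp a C f \<Longrightarrow> f \<in> borel_measurable borel"
  by (simp add: weak_Lp_def)

lemma weak_LpD: "weak_Lp a C f \<Longrightarrow> m > 0 \<Longrightarrow> emeasure lborel {x. ennreal (C * m powr - a) < f x} \<le> ennreal m"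
  by (simp add: weak_Lp_def)

lemma weak_Lp_dominate:
  fixes f :: "'a::euclidean_space \<Rightarrow> ennreal"
  assumes "weak_Lp a C g" and [measurable]: "f \<in> borel_measurable borel"
    and "\<And>x. f x \<le> g x" and "C \<le> D"
  shows "weak_Lp a D f"
  unfolding weak_Lp_def
proof (intro conjI allI impI)
  fix m :: real assume "m > 0"
  have [measurable]: "g \<in> borel_measurable borel"
    using assms(1) by (rule weak_Lp_measurable)
  have "ennreal (C * m powr - a) \<le> ennreal (D * m powr - a)"
    using \<open>C \<le> D\<close> by (intro ennreal_leI mult_right_mono) auto
  then have "emeasure lborel {x. ennreal (D * m powr - a) < f x}
      \<le> emeasure lborel {x. ennreal (C * m powr - a) < g x}"
    using assms(3) by (intro emeasure_mono) (auto intro: le_less_trans less_le_trans)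
  also have "\<dots> \<le> ennreal m"
    using assms(1) \<open>m > 0\<close> by (rule weak_LpD)
  finally show "emeasure lborel {x. ennreal (D * m powr - a) < f x} \<le> ennreal m" .
qed fact

lemma weak_Lp_mono:
  assumes "weak_Lp a C f" "C \<le> D"
  shows "weak_Lp a D f"
  by (rule weak_Lp_dominate[OF assms(1) weak_Lp_measurable[OF assms(1)] order_refl assms(2)])

text \<open>\<open>weak_Lp a C f\<close> bounds the decreasing rearrangement of \<open>f\<close> at
  \<open>m\<close> by \<open>C * m powr - a\<close>. Allowing \<open>f\<close> and \<open>g\<close>
  an exceptional set of measure \<open>m\<close> each gives one of measure \<open>2 * m\<close> for
  \<open>h\<close>; hence the \<open>2 * m\<close> in the pointwise hypothesis.\<close>

lemma weak_Lp_combine: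
  fixes f g h :: "'a::euclidean_space \<Rightarrow> ennreal"
  assumes f: "weak_Lp a C f" and g: "weak_Lp b D g"
    and [measurable]: "h \<in> borel_measurable borel"
    and h: "\<And>m x. m > 0 \<Longrightarrow> f x \<le> ennreal (C * m powr - a) \<Longrightarrow> g x \<le> ennreal (D * m powr - b)
            \<Longrightarrow> h x \<le> ennreal (B * (2 * m) powr - c)"
  shows "weak_Lp c B h"
  unfolding weak_Lp_def
proof (intro conjI allI impI)
  fix m :: real assume m: "m > 0"
  note [measurable] = weak_Lp_measurable[OF f] weak_Lp_measurable[OF g]
  let ?F = "{x. ennreal (C * (m/2) powr - a) < f x}" and ?G = "{x. ennreal (D * (m/2) powr - b) < g x}"
  have "{x. ennreal (B * m powr - c) < h x} \<subseteq> ?F \<union> ?G"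
    using h[of "m/2"] m by (force simp: not_less)
  then have "emeasure lborel {x. ennreal (B * m powr - c) < h x} \<le> emeasure lborel (?F \<union> ?G)"
    by (intro emeasure_mono) auto
  also have "\<dots> \<le> emeasure lborel ?F + emeasure lborel ?G"
    by (intro emeasure_subadditive) auto
  also have "\<dots> \<le> ennreal (m/2) + ennreal (m/2)"
    using f g m by (intro add_mono weak_LpD) auto
  also have "\<dots> = ennreal m"
    using m by (simp flip: ennreal_plus)
  finally show "emeasure lborel {x. ennreal (B * m powr - c) < h x} \<le> ennreal m" .
qed fact

text \<open>Weak Hoelder inequality: off the two exceptional sets the pointwise bounds multiply. The
  factor \<open>2 powr (a + b)\<close> pays for the doubled exceptional set.\<close>

lemma weak_Lp_mult:
  fixes f g :: "'a::euclidean_space \<Rightarrow> ennreal"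
  assumes f: "weak_Lp a C f" and g: "weak_Lp b D g" and "C \<ge> 0" "D \<ge> 0"
  shows "weak_Lp (a + b) (2 powr (a + b) * C * D) (\<lambda>x. f x * g x)"
proof (rule weak_Lp_combine[OF f g])
  note [measurable] = weak_Lp_measurable[OF f] weak_Lp_measurable[OF g]
  show "(\<lambda>x. f x * g x) \<in> borel_measurable borel" by measurable
  fix m :: real and x
  assume m: "m > 0" and "f x \<le> ennreal (C * m powr - a)" "g x \<le> ennreal (D * m powr - b)"
  then have "f x * g x \<le> ennreal (C * m powr - a) * ennreal (D * m powr - b)"
    by (intro mult_mono) auto
  also have "\<dots> = ennreal (2 powr (a + b) * C * D * (2 * m) powr - (a + b))"
  proof -
    have "2 powr (a + b) * (2 * m) powr - (a + b) = m powr - a * m powr - b"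
      using m by (simp add: powr_mult flip: powr_add)
    then have "2 powr (a + b) * C * D * (2 * m) powr - (a + b) = (C * m powr - a) * (D * m powr - b)"
      by (metis mult.assoc mult.commute)
    then show ?thesis
      using assms(3,4) by (simp only: ennreal_mult mult_nonneg_nonneg powr_ge_zero)
  qed
  finally show "f x * g x \<le> ennreal (2 powr (a + b) * C * D * (2 * m) powr - (a + b))" .
qed

lemma weak_Lp_add:
  fixes f g :: "'a::euclidean_space \<Rightarrow> ennreal"
  assumes f: "weak_Lp a C f" and g: "weak_Lp a D g" and "C \<ge> 0" "D \<ge> 0"
  shows "weak_Lp a (2 powr a * (C + D)) (\<lambda>x. f x + g x)"
proof (rule weak_Lp_combine[OF f g])
  note [measurable] = weak_Lp_measurable[OF f] weak_Lp_measurable[OF g]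
  show "(\<lambda>x. f x + g x) \<in> borel_measurable borel" by measurable
  fix m :: real and x
  assume m: "m > 0" and "f x \<le> ennreal (C * m powr - a)" "g x \<le> ennreal (D * m powr - a)"
  then have "f x + g x \<le> ennreal (C * m powr - a) + ennreal (D * m powr - a)"
    by (intro add_mono) auto
  also have "\<dots> = ennreal (2 powr a * (C + D) * (2 * m) powr - a)"
    using m assms(3,4)
    by (simp add: powr_mult powr_minus field_simps flip: ennreal_plus)
  finally show "f x + g x \<le> ennreal (2 powr a * (C + D) * (2 * m) powr - a)" .
qed

lemma weak_Lp_powr:
  fixes f :: "'a::euclidean_space \<Rightarrow> real"
  assumes f: "weak_Lp a C (\<lambda>x. ennreal (f x))" and C: "C \<ge> 0" and f0: "\<And>x. f x \<ge> 0" and q: "q > 0"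
    and [measurable]: "f \<in> borel_measurable borel"
  shows "weak_Lp (a * q) (C powr q) (\<lambda>x. ennreal (f x powr q))"
  unfolding weak_Lp_def
proof (intro conjI allI impI)
  fix m :: real assume m: "m > 0"
  have *: "C powr q * m powr - (a * q) = (C * m powr - a) powr q"
    using C by (simp add: powr_mult powr_powr)
  have "{x. ennreal (C powr q * m powr - (a * q)) < ennreal (f x powr q)} \<subseteq> {x. ennreal (C * m powr - a) < ennreal (f x)}"
  proof safe
    fix x assume "ennreal (C powr q * m powr - (a * q)) < ennreal (f x powr q)"
    then have "(C * m powr - a) powr q < f x powr q"
      unfolding * by (simp add: ennreal_less_iff)
    then have "C * m powr - a < f x"
      using powr_mono2[of q "f x" "C * m powr - a"] f0 q by (meson less_imp_le not_less)
    then show "ennreal (C * m powr - a) < ennreal (f x)"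
      using C by (simp add: ennreal_less_iff)
  qed
  then have "emeasure lborel {x. ennreal (C powr q * m powr - (a * q)) < ennreal (f x powr q)}
      \<le> emeasure lborel {x. ennreal (C * m powr - a) < ennreal (f x)}"
    by (intro emeasure_mono) auto
  also have "\<dots> \<le> ennreal m"
    using f m by (rule weak_LpD)
  finally show "emeasure lborel {x. ennreal (C powr q * m powr - (a * q)) < ennreal (f x powr q)} \<le> ennreal m" .
qed measurable

section \<open>Criteria for membership in weak Lebesgue spaces\<close>

lemma weak_Lp_Chebyshev:
  fixes f :: "'a::euclidean_space \<Rightarrow> real"
  assumes [measurable]: "f \<in> borel_measurable borel" and f0: "\<And>x. f x \<ge> 0" and r: "r > 0" and C: "C > 0"
    and int: "(\<integral>\<^sup>+x. ennreal (f x powr r) \<partial>lborel) \<le> ennreal (C powr r)"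
  shows "weak_Lp (1 / r) C (\<lambda>x. ennreal (f x))"
  unfolding weak_Lp_def
proof (intro conjI allI impI)
  fix m :: real assume m: "m > 0"
  \<comment> \<open>\<open>c\<close> normalises the threshold: \<open>c * t powr r = 1\<close> for
    \<open>t = C * m powr - (1 / r)\<close>. Markov's inequality then gives the measure bound
    \<open>c * C powr r = m\<close>.\<close>
  define c where "c = m * C powr - r"
  have c: "c > 0" using m C by (simp add: c_def)
  have *: "1 \<le> c * f x powr r" if "C * m powr - (1 / r) < f x" for x
  proof -
    have "1 = c * (C * m powr - (1 / r)) powr r"
    proof -
      have "(C * m powr - (1 / r)) powr r = C powr r * m powr - 1"
        using m C r by (simp add: powr_mult powr_powr)
      then show ?thesis
        unfolding c_def using m C by (simp only:) (simp add: powr_minus field_simps)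
    qed
    also have "\<dots> \<le> c * f x powr r"
      using that c C m r by (intro mult_left_mono powr_mono2) auto
    finally show ?thesis .
  qed
  have "{x. ennreal (C * m powr - (1 / r)) < ennreal (f x)} \<subseteq> {x\<in>UNIV. 1 \<le> ennreal c * ennreal (f x powr r)}"
    using * C m c f0 by (auto simp: ennreal_less_iff simp flip: ennreal_mult)
  then have "emeasure lborel {x. ennreal (C * m powr - (1 / r)) < ennreal (f x)}
     \<le> emeasure lborel {x\<in>UNIV. 1 \<le> ennreal c * ennreal (f x powr r)}"
    by (intro emeasure_mono) auto
  also have "\<dots> \<le> ennreal c * (\<integral>\<^sup>+x. ennreal (f x powr r) * indicator UNIV x \<partial>lborel)"
    by (intro nn_integral_Markov_inequality) auto
  also have "\<dots> \<le> ennreal c * ennreal (C powr r)"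
    using int by (intro mult_left_mono) auto
  also have "\<dots> = ennreal m"
    using m C c by (simp add: c_def powr_minus flip: ennreal_mult)
  finally show "emeasure lborel {x. ennreal (C * m powr - (1 / r)) < ennreal (f x)} \<le> ennreal m" .
qed measurable

lemma in_Lp_imp_weak_Lp:
  fixes f :: "'a::euclidean_space \<Rightarrow> real"
  assumes f: "in_Lp r f" and f0: "\<And>x. f x \<ge> 0" and r: "r > 0"
  shows "\<exists>C>0. weak_Lp (1 / r) C (\<lambda>x. ennreal (f x))"
proof -
  have [measurable]: "f \<in> borel_measurable borel" using f by (simp add: in_Lp_def)
  define I where "I = (\<integral>x. f x powr r \<partial>lborel)"
  have I: "I \<ge> 0" unfolding I_def by simp
  have "(\<integral>\<^sup>+x. ennreal (f x powr r) \<partial>lborel) = ennreal I"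
    unfolding I_def using f f0 by (intro nn_integral_eq_integral) (auto simp: in_Lp_def)
  \<comment> \<open>\<open>I + 1\<close> in place of \<open>I\<close> keeps the constant positive
    even when \<open>f\<close> vanishes almost everywhere.\<close>
  also have "\<dots> \<le> ennreal (((I + 1) powr (1 / r)) powr r)"
    using r I by (simp add: powr_powr)
  finally have "weak_Lp (1 / r) ((I + 1) powr (1 / r)) (\<lambda>x. ennreal (f x))"
    using f0 r I by (intro weak_Lp_Chebyshev) auto
  then show ?thesis using I by (intro exI[of _ "(I + 1) powr (1 / r)"]) auto
qed

text \<open>For \<open>m \<ge> b\<close> the superlevel set lies in \<open>B\<close>, which is small
  enough; for \<open>m < b\<close> the threshold is at least \<open>K\<close>, so the superlevel set
  is empty.\<close>

lemma weak_Lp_bounded_support: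
  fixes f :: "'a::euclidean_space \<Rightarrow> ennreal"
  assumes [measurable]: "f \<in> borel_measurable borel" "B \<in> sets borel"
    and f: "\<And>x. f x \<le> ennreal K" "\<And>x. x \<notin> B \<Longrightarrow> f x = 0"
    and K: "K \<ge> 0" and b: "b > 0" "emeasure lborel B \<le> ennreal b" and a: "a > 0"
  shows "weak_Lp a (K * b powr a) f"
  unfolding weak_Lp_def
proof (intro conjI allI impI)
  fix m :: real assume m: "m > 0"
  show "emeasure lborel {x. ennreal (K * b powr a * m powr - a) < f x} \<le> ennreal m"
  proof (cases "m \<ge> b")
    case True
    have "{x. ennreal (K * b powr a * m powr - a) < f x} \<subseteq> B"
    proof
      fix x assume "x \<in> {x. ennreal (K * b powr a * m powr - a) < f x}"
      then show "x \<in> B"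
        using f(2)[of x] by (cases "x \<in> B") auto
    qed
    then have "emeasure lborel {x. ennreal (K * b powr a * m powr - a) < f x} \<le> emeasure lborel B"
      by (intro emeasure_mono) auto
    also have "\<dots> \<le> ennreal m"
      using b(2) True by (meson ennreal_leI order_trans)
    finally show ?thesis .
  next
    case False
    have "K * 1 \<le> K * (b powr a * m powr - a)"
      using False m b a K by (intro mult_left_mono) (auto simp: powr_minus divide_simps powr_mono2)
    then have "f x \<le> ennreal (K * b powr a * m powr - a)" for x
      using order_trans[OF f(1)[of x] ennreal_leI] by (simp add: mult.assoc)
    then have "{x. ennreal (K * b powr a * m powr - a) < f x} = {}"
      by (simp add: not_less)
    then show ?thesis by simp
  qed
qed fact

text \<open>Superlevel sets of a negative power of the norm lie in balls, and volume scales like the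
  \<open>n\<close>-th power of the radius. This serves both for the weight and, with exponent
  \<open>n - \<alpha>\<close>, for the Riesz kernel.\<close>

lemma weak_Lp_norm_powr:
  assumes "\<sigma> \<ge> 0"
  defines "n \<equiv> real DIM('a::euclidean_space)"
  shows "weak_Lp (\<sigma> / n) (unit_ball_vol n powr (\<sigma> / n)) (\<lambda>x::'a. ennreal (norm x powr - \<sigma>))"
  unfolding weak_Lp_def
proof (intro conjI allI impI)
  fix m :: real assume m: "m > 0"
  have n: "n > 0" by (simp add: n_def)
  define w where "w = unit_ball_vol n"
  have w: "w > 0" using n by (simp add: w_def)
  \<comment> \<open>The ball of radius \<open>\<rho>\<close> has volume exactly
    \<open>m\<close>.\<close>
  define \<rho> where "\<rho> = (m / w) powr (1 / n)"
  have \<rho>: "\<rho> > 0" using m w by (simp add: \<rho>_def)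
  have eq: "w powr (\<sigma> / n) * m powr - (\<sigma> / n) = \<rho> powr - \<sigma>"
    using m w n by (simp add: \<rho>_def powr_powr powr_divide powr_minus divide_simps)
  have "{x::'a. ennreal (w powr (\<sigma> / n) * m powr - (\<sigma> / n)) < ennreal (norm x powr - \<sigma>)} \<subseteq> ball 0 \<rho>"
  proof safe
    fix x :: 'a assume *: "ennreal (w powr (\<sigma> / n) * m powr - (\<sigma> / n)) < ennreal (norm x powr - \<sigma>)"
    have "\<not> norm x \<ge> \<rho>"
    proof
      assume "norm x \<ge> \<rho>"
      then have "norm x powr - \<sigma> \<le> \<rho> powr - \<sigma>"
        using \<rho> \<open>\<sigma> \<ge> 0\<close> by (intro powr_mono2') auto
      then show False
        using * unfolding eq by (simp add: ennreal_less_iff)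
    qed
    then show "x \<in> ball 0 \<rho>" by simp
  qed
  then have "emeasure lborel {x::'a. ennreal (w powr (\<sigma> / n) * m powr - (\<sigma> / n)) < ennreal (norm x powr - \<sigma>)}
      \<le> emeasure lborel (ball 0 \<rho> :: 'a set)"
    by (intro emeasure_mono) auto
  also have "\<dots> = ennreal (w * \<rho> powr n)"
    using \<rho> by (simp add: emeasure_ball w_def n_def powr_realpow)
  also have "\<dots> = ennreal m"
    using m w n by (simp add: \<rho>_def powr_powr)
  finally show "emeasure lborel {x::'a. ennreal (unit_ball_vol n powr (\<sigma> / n) * m powr - (\<sigma> / n)) < ennreal (norm x powr - \<sigma>)} \<le> ennreal m"
    unfolding w_def .
qed measurable

section \<open>Level set decompositions\<close>

lemma nn_integral_lborel_reflect:
  fixes g :: "'a::euclidean_space \<Rightarrow> ennreal"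
  assumes [measurable]: "g \<in> borel_measurable borel"
  shows "(\<integral>\<^sup>+y. g (x - y) \<partial>lborel) = (\<integral>\<^sup>+y. g y \<partial>lborel)"
proof -
  have *: "(lborel :: 'a measure) = distr lborel borel (\<lambda>y. x - y)"
    by (subst lborel_affine[of "-1" x]) (simp_all add: density_1)
  show ?thesis
    by (subst (2) *, subst nn_integral_distr) auto
qed

lemma ennreal_le_suminf:
  fixes f :: "nat \<Rightarrow> ennreal"
  shows "f j \<le> (\<Sum>k. f k)"
  using sum_le_suminf[OF summableI, of "{j}" f] by simp

lemma suminf_geometric_powr:
  assumes "\<delta> < 0" "B \<ge> 0"
  shows "(\<Sum>k. ennreal (B * 2 powr (\<delta> * real k))) = ennreal (B / (1 - 2 powr \<delta>))"
proof (rule suminf_ennreal_eq)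
  have "2 powr \<delta> < (1::real)"
    using assms powr_less_one[of 2 \<delta>] by simp
  then have "(\<lambda>k. B * (2 powr \<delta>) ^ k) sums (B * (1 / (1 - 2 powr \<delta>)))"
    by (intro sums_mult geometric_sums) auto
  then show "(\<lambda>k. B * 2 powr (\<delta> * real k)) sums (B / (1 - 2 powr \<delta>))"
    by (simp add: powr_realpow[symmetric] powr_powr)
qed (use assms in auto)

text \<open>Dyadic layers going down: where \<open>K\<close> lies between the levels for
  \<open>2 * m\<close> and \<open>m\<close>, it is at most the upper level, and \<open>f\<close> is
  integrated over the superlevel set of the lower one. The layers form a geometric series of ratio
  \<open>2 powr (\<gamma> - \<beta>) < 1\<close>; the factor \<open>2 powr \<gamma>\<close> comes
  from the shift by one layer.\<close>

lemma nn_integral_sublevel_bound: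
  fixes K f :: "'a::euclidean_space \<Rightarrow> ennreal"
  assumes [measurable]: "K \<in> borel_measurable borel" "f \<in> borel_measurable borel"
    and D: "D \<ge> 0" and M: "M > 0" and \<beta>: "\<beta> > 0" and \<gamma>: "\<gamma> < \<beta>" and A: "A \<ge> 0"
    and bound: "\<And>m. m > 0 \<Longrightarrow>
      (\<integral>\<^sup>+x. f x * indicator {x. ennreal (D * m powr - \<beta>) < K x} x \<partial>lborel) \<le> ennreal (A * m powr \<gamma>)"
  shows "(\<integral>\<^sup>+x. K x * f x * indicator {x. K x \<le> ennreal (D * M powr - \<beta>)} x \<partial>lborel)
     \<le> ennreal (2 powr \<gamma> / (1 - 2 powr (\<gamma> - \<beta>)) * A * D * M powr (\<gamma> - \<beta>))"
proof -
  define m where "m k = M * 2 powr real k" for k :: nat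
  define l where "l = (\<lambda>k. ennreal (D * m k powr - \<beta>))"
  have m: "m k > 0" for k using M by (simp add: m_def)
  have l_lim: "l \<longlonglongrightarrow> 0"
  proof -
    have "(\<lambda>k. D * M powr - \<beta> * (2 powr - \<beta>) ^ k) \<longlonglongrightarrow> D * M powr - \<beta> * 0"
      using \<beta> powr_less_one[of 2 "-\<beta>"] by (intro tendsto_intros LIMSEQ_power_zero) auto
    moreover have "(\<lambda>k. D * m k powr - \<beta>) = (\<lambda>k. D * M powr - \<beta> * (2 powr - \<beta>) ^ k)"
      using M by (simp add: m_def powr_mult powr_powr powr_realpow[symmetric] mult_ac)
    ultimately have "(\<lambda>k. D * m k powr - \<beta>) \<longlonglongrightarrow> 0" by (simp only: mult_zero_right)
    from tendsto_ennrealI[OF this] show ?thesis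
      unfolding l_def by simp
  qed
  have pw: "K x * f x * indicator {x. K x \<le> ennreal (D * M powr - \<beta>)} x
      \<le> (\<Sum>k. l k * (f x * indicator {x. l (Suc k) < K x} x))" for x
  proof (cases "K x \<le> ennreal (D * M powr - \<beta>) \<and> K x > 0")
    case True
    have "eventually (\<lambda>k. l k < K x) sequentially"
      using l_lim True by (auto intro: order_tendstoD)
    then obtain k0 where "l k0 < K x" by (auto simp: eventually_sequentially)
    \<comment> \<open>The least \<open>k\<close> whose level drops below \<open>K x\<close> is
      positive, since \<open>K x\<close> is at most level 0. Its predecessor \<open>j\<close> gives
      the layer containing \<open>x\<close>.\<close>
    define k where "k = (LEAST k. l k < K x)"
    have k: "l k < K x" unfolding k_def using \<open>l k0 < K x\<close> by (rule LeastI)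
    have "k \<noteq> 0" using k True by (auto simp: l_def m_def intro!: gr0I)
    then obtain j where j: "k = Suc j" by (cases k) auto
    have "\<not> l j < K x" using not_less_Least[of j "\<lambda>k. l k < K x"] j k_def by auto
    then have "K x * f x * indicator {x. K x \<le> ennreal (D * M powr - \<beta>)} x \<le> l j * (f x * indicator {x. l (Suc j) < K x} x)"
      using k j True by (auto intro: mult_right_mono)
    also have "\<dots> \<le> (\<Sum>k. l k * (f x * indicator {x. l (Suc k) < K x} x))"
      by (rule ennreal_le_suminf[of "\<lambda>k. l k * (f x * indicator {x. l (Suc k) < K x} x)" j])
    finally show ?thesis .
  qed (auto split: split_indicator)
  have "(\<integral>\<^sup>+x. K x * f x * indicator {x. K x \<le> ennreal (D * M powr - \<beta>)} x \<partial>lborel)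
     \<le> (\<integral>\<^sup>+x. (\<Sum>k. l k * (f x * indicator {x. l (Suc k) < K x} x)) \<partial>lborel)"
    by (intro nn_integral_mono pw)
  also have "\<dots> = (\<Sum>k. l k * (\<integral>\<^sup>+x. f x * indicator {x. l (Suc k) < K x} x \<partial>lborel))"
    by (subst nn_integral_suminf) (auto simp: nn_integral_cmult)
  also have "\<dots> \<le> (\<Sum>k. l k * ennreal (A * m (Suc k) powr \<gamma>))"
    using bound[OF m] by (intro suminf_le mult_left_mono) (auto simp: l_def)
  also have "\<dots> = (\<Sum>k. ennreal (2 powr \<gamma> * A * D * M powr (\<gamma> - \<beta>) * 2 powr ((\<gamma> - \<beta>) * real k)))"
  proof (intro suminf_cong)
    fix k
    have "(D * m k powr - \<beta>) * (A * m (Suc k) powr \<gamma>) = 2 powr \<gamma> * A * D * M powr (\<gamma> - \<beta>) * 2 powr ((\<gamma> - \<beta>) * real k)"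
    proof -
      have "m k powr - \<beta> = M powr - \<beta> * 2 powr (- \<beta> * real k)"
        using M by (simp add: m_def powr_mult powr_powr mult_ac)
      moreover have "m (Suc k) powr \<gamma> = M powr \<gamma> * (2 powr \<gamma> * 2 powr (\<gamma> * real k))"
        using M by (simp add: m_def powr_mult powr_powr ring_distribs mult_ac flip: powr_add)
      moreover have "M powr (\<gamma> - \<beta>) = M powr \<gamma> * M powr - \<beta>"
        by (simp flip: powr_add)
      moreover have "2 powr ((\<gamma> - \<beta>) * real k) = 2 powr (\<gamma> * real k) * 2 powr (- \<beta> * real k)"
        by (simp add: ring_distribs flip: powr_add)
      ultimately show ?thesis by (simp only: mult_ac)
    qed
    then show "l k * ennreal (A * m (Suc k) powr \<gamma>) = ennreal (2 powr \<gamma> * A * D * M powr (\<gamma> - \<beta>) * 2 powr ((\<gamma> - \<beta>) * real k))"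
      using A D by (simp add: l_def flip: ennreal_mult)
  qed
  also have "\<dots> = ennreal (2 powr \<gamma> * A * D * M powr (\<gamma> - \<beta>) / (1 - 2 powr (\<gamma> - \<beta>)))"
    using A D \<gamma> by (intro suminf_geometric_powr) auto
  finally show ?thesis by (simp add: field_simps)
qed

text \<open>The set where \<open>f\<close> is infinite lies in every superlevel set. Its nullity is
  needed because an infinite value belongs to no dyadic layer.\<close>

lemma weak_Lp_AE_finite:
  fixes f :: "'a::euclidean_space \<Rightarrow> ennreal"
  assumes f: "weak_Lp a C f"
  shows "AE x in lborel. f x \<noteq> top"
proof -
  note [measurable] = weak_Lp_measurable[OF f]
  have *: "emeasure lborel {x. f x = top} \<le> ennreal m" if "m > 0" for m
  proof -
    have "emeasure lborel {x. f x = top} \<le> emeasure lborel {x. ennreal (C * m powr - a) < f x}"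
      by (intro emeasure_mono) auto
    also have "\<dots> \<le> ennreal m" using f that by (rule weak_LpD)
    finally show ?thesis .
  qed
  have "emeasure lborel {x. f x = top} \<le> 0"
    by (rule ennreal_le_epsilon) (simp add: *)
  then show ?thesis
    by (intro AE_I[of _ _ "{x. f x = top}"]) auto
qed

text \<open>Dyadic layers going up, with \<open>m k\<close> decreasing to 0: as
  \<open>\<beta> > 0\<close> the levels tend to infinity and exhaust all finite values, and as
  \<open>\<beta> < 1\<close> the products of level and measure are summable.\<close>

lemma weak_Lp_nn_integral_superlevel:
  fixes K :: "'a::euclidean_space \<Rightarrow> ennreal"
  assumes K: "weak_Lp \<beta> D K" and D: "D > 0" and M: "M > 0" and \<beta>: "0 < \<beta>" "\<beta> < 1"
  shows "(\<integral>\<^sup>+x. K x * indicator {x. ennreal (D * M powr - \<beta>) < K x} x \<partial>lborel)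
     \<le> ennreal (2 powr \<beta> / (1 - 2 powr (\<beta> - 1)) * D * M powr (1 - \<beta>))"
proof -
  note [measurable] = weak_Lp_measurable[OF K]
  define m where "m k = M * 2 powr - real k" for k :: nat
  define l where "l = (\<lambda>k. ennreal (D * m k powr - \<beta>))"
  have m: "m k > 0" for k using M by (simp add: m_def)
  have l_lim: "l \<longlonglongrightarrow> top"
  proof -
    have "filterlim ((^) (2 powr \<beta>)) at_top sequentially"
      using \<beta> by (intro filterlim_at_infinity_imp_filterlim_at_top filterlim_realpow_sequentially_gt1) auto
    then have "filterlim (\<lambda>k. D * M powr - \<beta> * (2 powr \<beta>) ^ k) at_top sequentially"
      using D M by (intro filterlim_tendsto_pos_mult_at_top[OF tendsto_const]) auto
    moreover have "(\<lambda>k. D * m k powr - \<beta>) = (\<lambda>k. D * M powr - \<beta> * (2 powr \<beta>) ^ k)"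
      using M by (simp add: m_def powr_mult powr_powr powr_realpow[symmetric] mult_ac)
    ultimately have "filterlim (\<lambda>k. D * m k powr - \<beta>) at_top sequentially" by (simp only:)
    then show ?thesis
      unfolding l_def by (simp only: ennreal_tendsto_top_eq_at_top)
  qed
  have pw: "K x * indicator {x. ennreal (D * M powr - \<beta>) < K x} x
      \<le> (\<Sum>k. l (Suc k) * indicator {x. l k < K x} x)" if "K x \<noteq> top" for x
  proof (cases "ennreal (D * M powr - \<beta>) < K x")
    case True
    have "eventually (\<lambda>k. K x < l k) sequentially"
      using l_lim that by (auto intro: order_tendstoD simp: top.not_eq_extremum)
    then obtain k0 where "K x \<le> l k0" by (auto simp: eventually_sequentially intro: less_imp_le)
    define k where "k = (LEAST k. K x \<le> l k)"
    have k: "K x \<le> l k" unfolding k_def using \<open>K x \<le> l k0\<close> by (rule LeastI)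
    have "k \<noteq> 0" using k True by (auto simp: l_def m_def intro!: gr0I)
    then obtain j where j: "k = Suc j" by (cases k) auto
    have "\<not> K x \<le> l j" using not_less_Least[of j "\<lambda>k. K x \<le> l k"] j k_def by auto
    then have "K x * indicator {x. ennreal (D * M powr - \<beta>) < K x} x \<le> l (Suc j) * indicator {x. l j < K x} x"
      using k j True by auto
    also have "\<dots> \<le> (\<Sum>k. l (Suc k) * indicator {x. l k < K x} x)"
      by (rule ennreal_le_suminf[of "\<lambda>k. l (Suc k) * indicator {x. l k < K x} x" j])
    finally show ?thesis .
  qed (auto split: split_indicator)
  have "(\<integral>\<^sup>+x. K x * indicator {x. ennreal (D * M powr - \<beta>) < K x} x \<partial>lborel)
     \<le> (\<integral>\<^sup>+x. (\<Sum>k. l (Suc k) * indicator {x. l k < K x} x) \<partial>lborel)"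
    using weak_Lp_AE_finite[OF K] pw by (intro nn_integral_mono_AE) auto
  also have "\<dots> = (\<Sum>k. l (Suc k) * emeasure lborel {x. l k < K x})"
    by (subst nn_integral_suminf) (auto simp: nn_integral_cmult)
  also have "\<dots> \<le> (\<Sum>k. l (Suc k) * ennreal (m k))"
    using weak_LpD[OF K m] by (intro suminf_le mult_left_mono) (auto simp: l_def)
  also have "\<dots> = (\<Sum>k. ennreal (2 powr \<beta> * D * M powr (1 - \<beta>) * 2 powr ((\<beta> - 1) * real k)))"
  proof (intro suminf_cong)
    fix k
    have "(D * m (Suc k) powr - \<beta>) * m k = 2 powr \<beta> * D * M powr (1 - \<beta>) * 2 powr ((\<beta> - 1) * real k)"
    proof -
      have "m (Suc k) powr - \<beta> = M powr - \<beta> * (2 powr \<beta> * 2 powr (\<beta> * real k))"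
        using M by (simp add: m_def powr_mult powr_powr ring_distribs mult_ac flip: powr_add)
      moreover have "M powr (1 - \<beta>) = M * M powr - \<beta>"
        using M by (simp add: powr_diff powr_minus divide_inverse)
      moreover have "2 powr ((\<beta> - 1) * real k) = 2 powr (\<beta> * real k) * 2 powr - real k"
        by (simp add: ring_distribs flip: powr_add)
      ultimately show ?thesis by (simp only: m_def mult_ac)
    qed
    then show "l (Suc k) * ennreal (m k) = ennreal (2 powr \<beta> * D * M powr (1 - \<beta>) * 2 powr ((\<beta> - 1) * real k))"
      using D m[of k] by (simp add: l_def flip: ennreal_mult)
  qed
  also have "\<dots> = ennreal (2 powr \<beta> * D * M powr (1 - \<beta>) / (1 - 2 powr (\<beta> - 1)))"
    using D \<beta> by (intro suminf_geometric_powr) auto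
  finally show ?thesis by (simp add: field_simps)
qed

text \<open>Cut \<open>f\<close> at the level belonging to measure \<open>M\<close>. The part below
  contributes at most level times \<open>M\<close>, which is the summand 1 in the constant; the part
  above is summed dyadically, whatever \<open>E\<close> is.\<close>

lemma weak_Lp_nn_integral_finite_set:
  fixes f :: "'a::euclidean_space \<Rightarrow> ennreal"
  assumes f: "weak_Lp a C f" and C: "C > 0" and a: "0 < a" "a < 1"
    and [measurable]: "E \<in> sets borel" and E: "emeasure lborel E \<le> ennreal M" and M: "M > 0"
  shows "(\<integral>\<^sup>+x. f x * indicator E x \<partial>lborel) \<le> ennreal ((1 + 2 powr a / (1 - 2 powr (a - 1))) * C * M powr (1 - a))"
proof -
  note [measurable] = weak_Lp_measurable[OF f]
  let ?S = "{x. ennreal (C * M powr - a) < f x}"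
  have a1: "2 powr (a - 1) < (1::real)"
    using a powr_less_one[of 2 "a - 1"] by simp
  have "(\<integral>\<^sup>+x. f x * indicator E x \<partial>lborel)
      \<le> (\<integral>\<^sup>+x. ennreal (C * M powr - a) * indicator E x + f x * indicator ?S x \<partial>lborel)"
    by (intro nn_integral_mono) (auto split: split_indicator simp: not_less add_increasing add_increasing2)
  also have "\<dots> = ennreal (C * M powr - a) * emeasure lborel E + (\<integral>\<^sup>+x. f x * indicator ?S x \<partial>lborel)"
    by (simp add: nn_integral_add nn_integral_cmult)
  also have "\<dots> \<le> ennreal (C * M powr - a) * ennreal M + ennreal (2 powr a / (1 - 2 powr (a - 1)) * C * M powr (1 - a))"
    using E weak_Lp_nn_integral_superlevel[OF f C M a] by (intro add_mono mult_left_mono) auto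
  also have "\<dots> = ennreal (C * M powr (1 - a) + 2 powr a / (1 - 2 powr (a - 1)) * C * M powr (1 - a))"
    using C M a1 by (simp add: powr_diff powr_minus divide_simps flip: ennreal_mult ennreal_plus)
  also have "C * M powr (1 - a) + 2 powr a / (1 - 2 powr (a - 1)) * C * M powr (1 - a) = (1 + 2 powr a / (1 - 2 powr (a - 1))) * C * M powr (1 - a)"
    by (simp add: algebra_simps)
  finally show ?thesis .
qed

section \<open>The weak Young inequality and weighted Riesz potentials\<close>

lemma weak_Lp_reflect:
  fixes f :: "'a::euclidean_space \<Rightarrow> ennreal"
  assumes f: "weak_Lp a C f"
  shows "weak_Lp a C (\<lambda>y. f (x - y))"
  unfolding weak_Lp_def
proof (intro conjI allI impI)
  note [measurable] = weak_Lp_measurable[OF f]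
  show "(\<lambda>y. f (x - y)) \<in> borel_measurable borel" by measurable
  fix m :: real assume m: "m > 0"
  let ?S = "{z. ennreal (C * m powr - a) < f z}"
  let ?T = "{y. ennreal (C * m powr - a) < f (x - y)}"
  have "emeasure lborel ?T = (\<integral>\<^sup>+y. indicator ?T y \<partial>lborel)"
    by simp
  also have "\<dots> = (\<integral>\<^sup>+y. indicator ?S (x - y) \<partial>lborel)"
    by (intro nn_integral_cong) (simp split: split_indicator)
  also have "\<dots> = emeasure lborel ?S"
    by (subst nn_integral_lborel_reflect) auto
  also have "\<dots> \<le> ennreal m"
    using f m by (rule weak_LpD)
  finally show "emeasure lborel {y. ennreal (C * m powr - a) < f (x - y)} \<le> ennreal m" .
qed

lemma weak_Lp_translate:
  fixes f :: "'a::euclidean_space \<Rightarrow> ennreal"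
  assumes "weak_Lp a C f"
  shows "weak_Lp a C (\<lambda>y. f (y - z))"
  using weak_Lp_reflect[OF weak_Lp_reflect[OF assms, of 0], of z] by simp

text \<open>Exhaustion by balls. It serves the testing argument for the weak Young inequality, which
  cancels a power of the measure of the test set and so needs that measure to be finite.\<close>

lemma emeasure_lborel_le_finite_subsets:
  fixes S :: "'a::euclidean_space set"
  assumes [measurable]: "S \<in> sets borel"
    and *: "\<And>E. E \<in> sets borel \<Longrightarrow> E \<subseteq> S \<Longrightarrow> emeasure lborel E < top \<Longrightarrow> emeasure lborel E \<le> M"
  shows "emeasure lborel S \<le> M"
proof -
  define E where "E k = S \<inter> ball 0 (real k)" for k :: nat
  have [measurable]: "E k \<in> sets borel" for k by (simp add: E_def)
  have U: "(\<Union>k. E k) = S"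
    by (auto simp: E_def) (meson reals_Archimedean2)
  have "incseq E"
    unfolding incseq_def E_def by (auto intro: less_le_trans)
  then have "emeasure lborel S = (SUP k. emeasure lborel (E k))"
    using SUP_emeasure_incseq[of E lborel] U by (simp add: image_subset_iff)
  also have "\<dots> \<le> M"
  proof (intro SUP_least *)
    fix k
    have "emeasure lborel (E k) \<le> emeasure lborel (ball 0 (real k) :: 'a set)"
      by (intro emeasure_mono) (auto simp: E_def)
    also have "\<dots> < top" by (simp add: emeasure_ball)
    finally show "emeasure lborel (E k) < top" .
  qed (auto simp: E_def)
  finally show ?thesis .
qed

text \<open>Weak Young inequality (O'Neil). Truncating the kernel at the level attained on a set of measure
  \<open>M\<close> makes the far part bounded pointwise, while the near part is an integrable kernel; testing the
  near part against a subset of its superlevel set closes the estimate.\<close>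

lemma weak_Lp_convolution:
  fixes \<beta> \<tau> :: real
  assumes \<beta>: "0 < \<beta>" "\<beta> < 1" and \<tau>: "0 < \<tau>" "\<tau> < 1" and \<tau>\<beta>: "\<tau> + \<beta> > 1"
  obtains B where "B > 0"
    "\<And>k f C D. \<lbrakk>weak_Lp \<beta> D k; weak_Lp \<tau> C f; C > 0; D > 0\<rbrakk> \<Longrightarrow>
       weak_Lp (\<tau> + \<beta> - 1) (B * C * D) (\<lambda>x::'a::euclidean_space. \<integral>\<^sup>+y. k (x - y) * f y \<partial>lborel)"
proof -
  \<comment> \<open>\<open>c\<close> is the constant for integrating \<open>f\<close> over a set of
    given measure, \<open>b1\<close> that for the near part of the kernel, and \<open>b2\<close>
    that for the far part, summed dyadically with \<open>\<gamma> = 1 - \<tau>\<close>.\<close>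
  define c where "c = 1 + 2 powr \<tau> / (1 - 2 powr (\<tau> - 1))"
  define b1 where "b1 = 2 powr \<beta> / (1 - 2 powr (\<beta> - 1))"
  define b2 where "b2 = 2 powr (1 - \<tau>) / (1 - 2 powr (1 - \<tau> - \<beta>))"
  have lt1: "2 powr (\<tau> - 1) < (1::real)" "2 powr (\<beta> - 1) < (1::real)" "2 powr (1 - \<tau> - \<beta>) < (1::real)"
    using \<beta> \<tau> \<tau>\<beta> powr_less_one[of 2] by auto
  have pos: "c > 0" "b1 > 0" "b2 > 0"
    using lt1 by (auto simp: c_def b1_def b2_def intro!: add_pos_pos divide_pos_pos)
  define B where "B = c * (b1 + b2)"
  have B: "B > 0" using pos by (simp add: B_def)
  have "weak_Lp (\<tau> + \<beta> - 1) (2 * B * C * D) (\<lambda>x::'a. \<integral>\<^sup>+y. k (x - y) * f y \<partial>lborel)"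
    if k: "weak_Lp \<beta> D k" and f: "weak_Lp \<tau> C f" and C: "C > 0" and D: "D > 0" for k f C D
    unfolding weak_Lp_def
  proof (intro conjI allI impI)
    note [measurable] = weak_Lp_measurable[OF k] weak_Lp_measurable[OF f]
    show "(\<lambda>x::'a. \<integral>\<^sup>+y. k (x - y) * f y \<partial>lborel) \<in> borel_measurable borel" by measurable
    fix M :: real assume M: "M > 0"
    define l where "l = ennreal (D * M powr - \<beta>)"
    \<comment> \<open>\<open>L\<close> is half the level to be proved: the far part never exceeds
      \<open>L\<close>, so only the near part can cause an exceedance.\<close>
    define L where "L = B * C * D * M powr (1 - \<tau> - \<beta>)"
    have L: "L > 0" using B C D M by (simp add: L_def)
    define k1 where "k1 z = k z * indicator {z. l < k z} z" for z
    have [measurable]: "k1 \<in> borel_measurable borel" unfolding k1_def by measurable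
    define near where "near x = (\<integral>\<^sup>+y. k1 (x - y) * f y \<partial>lborel)" for x
    define far where "far x = (\<integral>\<^sup>+y. k (x - y) * f y * indicator {y. k (x - y) \<le> l} y \<partial>lborel)" for x
    have [measurable]: "near \<in> borel_measurable borel" unfolding near_def by measurable
    have split: "(\<integral>\<^sup>+y. k (x - y) * f y \<partial>lborel) = near x + far x" for x
      unfolding near_def far_def
      by (subst nn_integral_add[symmetric])
         (auto simp: k1_def not_less split: split_indicator intro!: nn_integral_cong)
    have far: "far x \<le> ennreal L" for x
    proof -
      have kx: "weak_Lp \<beta> D (\<lambda>y. k (x - y))" using k by (rule weak_Lp_reflect)
      note [measurable] = weak_Lp_measurable[OF kx]
      have "far x \<le> ennreal (2 powr (1 - \<tau>) / (1 - 2 powr (1 - \<tau> - \<beta>)) * (c * C) * D * M powr (1 - \<tau> - \<beta>))"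
        unfolding far_def l_def
      proof (rule nn_integral_sublevel_bound)
        fix m :: real assume m: "m > 0"
        show "(\<integral>\<^sup>+y. f y * indicator {y. ennreal (D * m powr - \<beta>) < k (x - y)} y \<partial>lborel)
            \<le> ennreal (c * C * m powr (1 - \<tau>))"
          unfolding c_def
          by (rule weak_Lp_nn_integral_finite_set[OF f C \<tau> _ weak_LpD[OF kx m] m]) measurable
      qed (use D M \<beta> \<tau>\<beta> C pos in auto)
      also have "\<dots> = ennreal (c * b2 * C * D * M powr (1 - \<tau> - \<beta>))"
        by (simp add: b2_def mult_ac)
      also have "\<dots> \<le> ennreal L"
        unfolding L_def B_def using pos C D by (intro ennreal_leI mult_right_mono) auto
      finally show ?thesis .
    qed
    let ?S = "{x. ennreal L < near x}"
    have S: "emeasure lborel ?S \<le> ennreal M"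
    proof (rule emeasure_lborel_le_finite_subsets)
      fix E :: "'a set" assume [measurable]: "E \<in> sets borel" and sub: "E \<subseteq> ?S" and fin: "emeasure lborel E < top"
      obtain e where e: "e \<ge> 0" "emeasure lborel E = ennreal e"
        using fin by (cases "emeasure lborel E") auto
      show "emeasure lborel E \<le> ennreal M"
      proof (cases "e = 0")
        case False
        with e have e0: "e > 0" by simp
        have "ennreal (L * e) = (\<integral>\<^sup>+x. ennreal L * indicator E x \<partial>lborel)"
          using e L by (simp add: nn_integral_cmult ennreal_mult)
        also have "\<dots> \<le> (\<integral>\<^sup>+x. near x * indicator E x \<partial>lborel)"
          using sub by (intro nn_integral_mono) (auto split: split_indicator intro: less_imp_le)
        \<comment> \<open>After the substitution \<open>z = x - y\<close>, Fubini integrates over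
          \<open>x\<close> in \<open>E\<close> first. All translates of \<open>f\<close> obey the
          same bound there, and what remains is the integral of \<open>k1\<close>.\<close>
        also have "\<dots> = (\<integral>\<^sup>+x. (\<integral>\<^sup>+z. k1 z * (f (x - z) * indicator E x) \<partial>lborel) \<partial>lborel)"
        proof (intro nn_integral_cong)
          fix x
          have "near x = (\<integral>\<^sup>+z. k1 z * f (x - z) \<partial>lborel)"
            unfolding near_def using nn_integral_lborel_reflect[of "\<lambda>z. k1 z * f (x - z)" x] by simp
          then show "near x * indicator E x = (\<integral>\<^sup>+z. k1 z * (f (x - z) * indicator E x) \<partial>lborel)"
            by (simp add: nn_integral_multc mult.assoc[symmetric])
        qed
        also have "\<dots> = (\<integral>\<^sup>+z. (\<integral>\<^sup>+x. k1 z * (f (x - z) * indicator E x) \<partial>lborel) \<partial>lborel)"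
          by (rule lborel_pair.Fubini') measurable
        also have "\<dots> = (\<integral>\<^sup>+z. k1 z * (\<integral>\<^sup>+x. f (x - z) * indicator E x \<partial>lborel) \<partial>lborel)"
          by (intro nn_integral_cong nn_integral_cmult) measurable
        also have "\<dots> \<le> (\<integral>\<^sup>+z. k1 z * ennreal (c * C * e powr (1 - \<tau>)) \<partial>lborel)"
        proof (intro nn_integral_mono mult_left_mono)
          fix z
          show "(\<integral>\<^sup>+x. f (x - z) * indicator E x \<partial>lborel) \<le> ennreal (c * C * e powr (1 - \<tau>))"
            unfolding c_def
            by (rule weak_Lp_nn_integral_finite_set[OF weak_Lp_translate[OF f] C \<tau>]) (use e e0 in auto)
        qed auto
        also have "\<dots> = (\<integral>\<^sup>+z. k1 z \<partial>lborel) * ennreal (c * C * e powr (1 - \<tau>))"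
          by (rule nn_integral_multc) measurable
        also have "\<dots> \<le> ennreal (b1 * D * M powr (1 - \<beta>)) * ennreal (c * C * e powr (1 - \<tau>))"
          unfolding k1_def l_def b1_def
          by (intro mult_right_mono weak_Lp_nn_integral_superlevel k D M \<beta>) auto
        also have "\<dots> = ennreal (c * b1 * C * D * (M powr (1 - \<beta>) * e powr (1 - \<tau>)))"
          using pos C D by (simp add: mult_ac flip: ennreal_mult)
        also have "\<dots> \<le> ennreal (B * C * D * (M powr (1 - \<beta>) * e powr (1 - \<tau>)))"
          unfolding B_def using pos C D by (intro ennreal_leI mult_right_mono) auto
        \<comment> \<open>Cancelling the common positive factors turns this into
          \<open>e powr \<tau> \<le> M powr \<tau>\<close>, hence \<open>e \<le> M\<close>.\<close>
        finally have "L * e \<le> B * C * D * (M powr (1 - \<beta>) * e powr (1 - \<tau>))"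
          using B C D by simp
        then have "(B * C * D) * (M powr (1 - \<tau> - \<beta>) * e) \<le> (B * C * D) * (M powr (1 - \<beta>) * e powr (1 - \<tau>))"
          by (simp add: L_def mult.assoc)
        moreover have "B * C * D > 0" using B C D by simp
        ultimately have "M powr (1 - \<tau> - \<beta>) * e \<le> M powr (1 - \<beta>) * e powr (1 - \<tau>)"
          by (simp only: mult_le_cancel_left_pos)
        moreover have "M powr (1 - \<tau> - \<beta>) = M powr (1 - \<beta>) * M powr - \<tau>"
          by (simp add: algebra_simps flip: powr_add)
        moreover have "e = e powr (1 - \<tau>) * e powr \<tau>"
          using e0 by (simp flip: powr_add)
        ultimately have "(M powr (1 - \<beta>) * e powr (1 - \<tau>)) * (M powr - \<tau> * e powr \<tau>) \<le> (M powr (1 - \<beta>) * e powr (1 - \<tau>)) * 1"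
          by (metis mult.assoc mult.commute mult_1_right)
        moreover have "M powr (1 - \<beta>) * e powr (1 - \<tau>) > 0" using M e0 by simp
        ultimately have "M powr - \<tau> * e powr \<tau> \<le> 1"
          by (simp only: mult_le_cancel_left_pos)
        then have "e powr \<tau> \<le> M powr \<tau>"
          using M by (simp add: powr_minus field_simps)
        then have "e \<le> M"
          using powr_less_mono2[of \<tau> M e] M \<tau> by (meson less_imp_le not_less)
        then show ?thesis using e by (simp add: ennreal_leI)
      qed (use e in simp)
    qed measurable
    have "{x. ennreal (2 * B * C * D * M powr - (\<tau> + \<beta> - 1)) < (\<integral>\<^sup>+y. k (x - y) * f y \<partial>lborel)} \<subseteq> ?S"
    proof safe
      fix x assume *: "ennreal (2 * B * C * D * M powr - (\<tau> + \<beta> - 1)) < (\<integral>\<^sup>+y. k (x - y) * f y \<partial>lborel)"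
      have "2 * B * C * D * M powr - (\<tau> + \<beta> - 1) = L + L"
        by (simp add: L_def algebra_simps)
      then have **: "ennreal L + ennreal L < near x + far x"
        using * L by (simp only: split ennreal_plus less_imp_le)
      show "ennreal L < near x"
      proof (rule ccontr)
        assume "\<not> ennreal L < near x"
        then have "near x + far x \<le> ennreal L + ennreal L"
          using far[of x] by (intro add_mono) auto
        then show False using ** by simp
      qed
    qed
    then have "emeasure lborel {x. ennreal (2 * B * C * D * M powr - (\<tau> + \<beta> - 1)) < (\<integral>\<^sup>+y. k (x - y) * f y \<partial>lborel)} \<le> emeasure lborel ?S"
      by (intro emeasure_mono) auto
    also note S
    finally show "emeasure lborel {x. ennreal (2 * B * C * D * M powr - (\<tau> + \<beta> - 1)) < (\<integral>\<^sup>+y. k (x - y) * f y \<partial>lborel)} \<le> ennreal M" .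
  qed
  then show ?thesis
    using that[of "2 * B"] B by simp
qed

section \<open>Weighted Riesz potentials\<close>

text \<open>Since \<open>0 powr c = 0\<close>, the kernel vanishes on the null set where it is singular.\<close>

definition riesz :: "real \<Rightarrow> real \<Rightarrow> ('a::euclidean_space \<Rightarrow> ennreal) \<Rightarrow> 'a \<Rightarrow> ennreal" where
  "riesz \<alpha> \<sigma> f x =
     (\<integral>\<^sup>+y. ennreal (norm (x - y) powr - (real DIM('a) - \<alpha>)) * (ennreal (norm y powr - \<sigma>) * f y) \<partial>lborel)"

text \<open>By weak Hoelder, weight times \<open>f\<close> has exponent
  \<open>\<tau> = a + \<alpha> / n\<close>; the kernel has
  \<open>\<beta> = 1 - \<alpha> / n\<close>, so \<open>\<tau> + \<beta> - 1 = a\<close>. The two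
  bounds on \<open>a\<close> are exactly the Young conditions \<open>\<tau> + \<beta> > 1\<close>
  and \<open>\<tau> < 1\<close>.\<close>

lemma weak_Lp_riesz:
  fixes \<alpha> \<sigma> a b :: real
  defines "n \<equiv> real DIM('a::euclidean_space)"
  assumes \<alpha>: "0 < \<alpha>" "\<alpha> < n" and \<sigma>: "\<sigma> \<ge> 0" and a: "0 < a" "a < (n - \<alpha>) / n"
    and b: "b = a + (\<alpha> - \<sigma>) / n"
  obtains c where "c > 0"
    "\<And>f C. \<lbrakk>weak_Lp b C f; C > 0\<rbrakk> \<Longrightarrow> weak_Lp a (c * C) (riesz \<alpha> \<sigma> (f :: 'a \<Rightarrow> ennreal))"
proof -
  have n: "n > 0" by (simp add: n_def)
  define \<beta> where "\<beta> = (n - \<alpha>) / n"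
  define \<tau> where "\<tau> = \<sigma> / n + b"
  have \<tau>: "\<tau> = a + \<alpha> / n" by (simp add: \<tau>_def b diff_divide_distrib)
  have \<beta>1: "\<beta> = 1 - \<alpha> / n" using n by (simp add: \<beta>_def diff_divide_distrib)
  have *: "0 < \<beta>" "\<beta> < 1" "0 < \<tau>" "\<tau> < 1" "\<tau> + \<beta> > 1" and eq: "\<tau> + \<beta> - 1 = a"
    using n \<alpha> a by (auto simp: \<tau> \<beta>1 add_pos_pos simp flip: \<beta>_def)
  obtain B where B: "B > 0"
    "\<And>k f C D. \<lbrakk>weak_Lp \<beta> D k; weak_Lp \<tau> C f; C > 0; D > 0\<rbrakk> \<Longrightarrow>
       weak_Lp (\<tau> + \<beta> - 1) (B * C * D) (\<lambda>x::'a. \<integral>\<^sup>+y. k (x - y) * f y \<partial>lborel)"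
    using weak_Lp_convolution[OF *, where 'a='a] by blast
  define w where "w = unit_ball_vol n"
  have w: "w > 0" using n by (simp add: w_def)
  show ?thesis
  proof (rule that)
    let ?c = "B * (2 powr \<tau> * w powr (\<sigma> / n)) * w powr \<beta>"
    show "?c > 0" using B w by simp
    fix f :: "'a \<Rightarrow> ennreal" and C :: real assume f: "weak_Lp b C f" and C: "C > 0"
    have "weak_Lp \<beta> (w powr \<beta>) (\<lambda>x::'a. ennreal (norm x powr - (n - \<alpha>)))"
      unfolding \<beta>_def w_def n_def using \<alpha> by (intro weak_Lp_norm_powr) (simp add: n_def)
    moreover have "weak_Lp \<tau> (2 powr \<tau> * w powr (\<sigma> / n) * C) (\<lambda>y. ennreal (norm y powr - \<sigma>) * f y)"
      unfolding \<tau>_def w_def n_def using \<sigma> f C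
      by (intro weak_Lp_mult weak_Lp_norm_powr) (auto simp: n_def)
    ultimately have "weak_Lp (\<tau> + \<beta> - 1) (B * (2 powr \<tau> * w powr (\<sigma> / n) * C) * w powr \<beta>)
        (\<lambda>x::'a. \<integral>\<^sup>+y. ennreal (norm (x - y) powr - (n - \<alpha>)) * (ennreal (norm y powr - \<sigma>) * f y) \<partial>lborel)"
      using w C by (intro B) auto
    moreover have "B * (2 powr \<tau> * w powr (\<sigma> / n) * C) * w powr \<beta> = ?c * C" by simp
    ultimately show "weak_Lp a (?c * C) (riesz \<alpha> \<sigma> f)"
      unfolding riesz_def[abs_def] n_def[symmetric] eq by (simp only:)
  qed
qed

section \<open>Interpolation and regularity lifting\<close>

text \<open>With \<open>g\<close> the \<open>r\<close>-th power of \<open>f\<close>, the bound with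
  \<open>a1 * r < 1\<close> makes \<open>g\<close> integrable where it is large, and the bound with
  \<open>a2 * r > 1\<close> where it is small.\<close>

lemma in_Lp_interpolation:
  fixes f :: "'a::euclidean_space \<Rightarrow> real"
  assumes [measurable]: "f \<in> borel_measurable borel" and f0: "\<And>x. f x \<ge> 0" and r: "r > 0"
    and w1: "weak_Lp a1 C1 (\<lambda>x. ennreal (f x))" "C1 > 0" "0 < a1" "a1 < 1 / r"
    and w2: "weak_Lp a2 C2 (\<lambda>x. ennreal (f x))" "C2 > 0" "1 / r < a2"
  shows "in_Lp r f"
proof -
  define g where "g x = ennreal (f x powr r)" for x
  have [measurable]: "g \<in> borel_measurable borel" unfolding g_def by measurable
  have g1: "weak_Lp (a1 * r) (C1 powr r) g" and g2: "weak_Lp (a2 * r) (C2 powr r) g"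
    unfolding g_def[abs_def] using w1 w2 r f0 by (auto intro!: weak_Lp_powr)
  \<comment> \<open>The cut is the level of the second bound at \<open>m = 1\<close>, so the set
    above it has measure at most 1.\<close>
  let ?l = "ennreal (C2 powr r * 1 powr - (a2 * r))"
  have "a1 * r < 1" "1 < a2 * r" "0 < a1 * r" "0 < a2 * r"
    using w1 w2 r by (auto simp: field_simps intro: less_trans[of _ 1])
  note * = this
  have "(\<integral>\<^sup>+x. g x * indicator {x. ?l < g x} x \<partial>lborel)
      \<le> ennreal ((1 + 2 powr (a1 * r) / (1 - 2 powr (a1 * r - 1))) * C1 powr r * 1 powr (1 - a1 * r))"
    using * w1 w2 weak_LpD[OF g2, of 1] by (intro weak_Lp_nn_integral_finite_set g1) auto
  also have "\<dots> < top" by simp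
  finally have high: "(\<integral>\<^sup>+x. g x * indicator {x. ?l < g x} x \<partial>lborel) < top" .
  \<comment> \<open>The sublevel estimate with weight function 1: its hypothesis is then the weak
    bound itself, with \<open>A = 1\<close> and \<open>\<gamma> = 1\<close>.\<close>
  have "(\<integral>\<^sup>+x. g x * 1 * indicator {x. g x \<le> ?l} x \<partial>lborel)
      \<le> ennreal (2 powr 1 / (1 - 2 powr (1 - a2 * r)) * 1 * C2 powr r * 1 powr (1 - a2 * r))"
    using * weak_LpD[OF g2] by (intro nn_integral_sublevel_bound) auto
  also have "\<dots> < top" by simp
  finally have low: "(\<integral>\<^sup>+x. g x * indicator {x. g x \<le> ?l} x \<partial>lborel) < top" by simp
  have "(\<integral>\<^sup>+x. g x \<partial>lborel)
      = (\<integral>\<^sup>+x. g x * indicator {x. ?l < g x} x + g x * indicator {x. g x \<le> ?l} x \<partial>lborel)"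
    by (intro nn_integral_cong) (auto simp: not_less split: split_indicator)
  also have "\<dots> < top"
    using high low by (subst nn_integral_add) auto
  finally have "(\<integral>\<^sup>+x. ennreal (\<bar>f x\<bar> powr r) \<partial>lborel) < \<infinity>"
    using f0 by (simp add: g_def)
  then have "integrable lborel (\<lambda>x. \<bar>f x\<bar> powr r)"
    by (intro integrableI_nonneg) auto
  then show ?thesis by (simp add: in_Lp_def)
qed

text \<open>Where \<open>u\<close> exceeds twice the level of \<open>S\<close>, either
  \<open>S\<close> or \<open>D\<close> exceeds that level. The first happens on measure at most
  \<open>m\<close>; the second on measure at most any prescribed \<open>e\<close> once
  \<open>k\<close> is large, whatever the exponent \<open>a0\<close>.\<close>

lemma weak_Lp_approximation:
  fixes u :: "'a::euclidean_space \<Rightarrow> ennreal"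
  assumes C: "C > 0" and C0: "C0 > 0" and [measurable]: "u \<in> borel_measurable borel"
    and approx: "\<And>k::nat. \<exists>S D. weak_Lp a C S \<and> weak_Lp a0 (C0 / 4 ^ k) D \<and> u = (\<lambda>x. S x + D x)"
  shows "weak_Lp a (2 * C) u"
  unfolding weak_Lp_def
proof (intro conjI allI impI)
  fix m :: real assume m: "m > 0"
  let ?U = "{x. ennreal (2 * C * m powr - a) < u x}"
  define l where "l = C * m powr - a"
  have l: "l > 0" using C m by (simp add: l_def)
  show "emeasure lborel ?U \<le> ennreal m"
  proof (rule ennreal_le_epsilon)
    fix e :: real assume e: "e > 0"
    \<comment> \<open>\<open>d\<close> is the constant for which the bound
      \<open>d * e powr - a0\<close> on \<open>D\<close> equals the level \<open>l\<close>.\<close>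
    define d where "d = l * e powr a0"
    have d: "d > 0" using l e by (simp add: d_def)
    obtain k where "C0 / d < 4 ^ k"
      using real_arch_pow[of 4 "C0 / d"] by auto
    then have k: "C0 / 4 ^ k \<le> d"
      using d by (simp add: field_simps)
    obtain S D where S: "weak_Lp a C S" and D: "weak_Lp a0 (C0 / 4 ^ k) D" and u: "u = (\<lambda>x. S x + D x)"
      using approx by blast
    note [measurable] = weak_Lp_measurable[OF S] weak_Lp_measurable[OF D]
    have le: "C0 / 4 ^ k * e powr - a0 \<le> l"
      using mult_right_mono[OF k, of "e powr - a0"] e by (simp add: d_def mult.assoc flip: powr_add)
    have "?U \<subseteq> {x. ennreal l < S x} \<union> {x. ennreal (C0 / 4 ^ k * e powr - a0) < D x}"
    proof (rule subsetI, rule ccontr)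
      fix x assume x: "x \<in> ?U" and "x \<notin> {x. ennreal l < S x} \<union> {x. ennreal (C0 / 4 ^ k * e powr - a0) < D x}"
      then have "S x \<le> ennreal l" and Dx: "D x \<le> ennreal (C0 / 4 ^ k * e powr - a0)"
        by (simp_all add: not_less)
      then have "u x \<le> ennreal l + ennreal l"
        unfolding u using order_trans[OF Dx ennreal_leI[OF le]] by (intro add_mono)
      also have "\<dots> = ennreal (2 * C * m powr - a)"
        using l by (simp add: l_def flip: ennreal_plus)
      finally show False using x by simp
    qed
    then have "emeasure lborel ?U
      \<le> emeasure lborel ({x. ennreal l < S x} \<union> {x. ennreal (C0 / 4 ^ k * e powr - a0) < D x})"
      by (intro emeasure_mono) auto
    also have "\<dots> \<le> emeasure lborel {x. ennreal l < S x} + emeasure lborel {x. ennreal (C0 / 4 ^ k * e powr - a0) < D x}"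
      by (intro emeasure_subadditive) auto
    also have "\<dots> \<le> ennreal m + ennreal e"
      unfolding l_def by (intro add_mono weak_LpD[OF S m] weak_LpD[OF D e])
    finally show "emeasure lborel ?U \<le> ennreal m + ennreal e" .
  qed
qed fact

text \<open>Regularity lifting: \<open>u\<close> and \<open>v\<close> split into Picard iterates, which stay bounded in the target
  spaces (exponents \<open>a\<close>, \<open>b\<close>), and remainders \<open>T\<^sup>k u\<close>, which tend to zero in the spaces where \<open>u\<close>
  and \<open>v\<close> are already known to lie (exponents \<open>a0\<close>, \<open>b0\<close>).\<close>

lemma weak_Lp_regularity_lifting:
  fixes T1 T2 :: "('a::euclidean_space \<Rightarrow> ennreal) \<Rightarrow> 'a \<Rightarrow> ennreal"
  assumes add1: "\<And>f g. f \<in> borel_measurable borel \<Longrightarrow> g \<in> borel_measurable borel \<Longrightarrow>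
        T1 (\<lambda>x. f x + g x) = (\<lambda>x. T1 f x + T1 g x)"
    and add2: "\<And>f g. f \<in> borel_measurable borel \<Longrightarrow> g \<in> borel_measurable borel \<Longrightarrow>
        T2 (\<lambda>x. f x + g x) = (\<lambda>x. T2 f x + T2 g x)"
    and X1: "\<And>f C. weak_Lp b0 C f \<Longrightarrow> C > 0 \<Longrightarrow> weak_Lp a0 (C / 4) (T1 f)"
    and X2: "\<And>f C. weak_Lp a0 C f \<Longrightarrow> C > 0 \<Longrightarrow> weak_Lp b0 (C / 4) (T2 f)"
    and Y1: "\<And>f C. weak_Lp b C f \<Longrightarrow> C > 0 \<Longrightarrow> weak_Lp a (C / 4) (T1 f)"
    and Y2: "\<And>f C. weak_Lp a C f \<Longrightarrow> C > 0 \<Longrightarrow> weak_Lp b (C / 4) (T2 f)"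
    and F: "weak_Lp a CF F1" "weak_Lp b CF F2" "CF > 0"
    and uv: "weak_Lp a0 C0 u" "weak_Lp b0 C0 v" "C0 > 0"
    and ab: "a \<le> 1" "b \<le> 1"
    and u: "u = (\<lambda>x. T1 v x + F1 x)" and v: "v = (\<lambda>x. T2 u x + F2 x)"
  shows "weak_Lp a (8 * CF) u" "weak_Lp b (8 * CF) v"
proof -
  \<comment> \<open>For \<open>c \<le> 1\<close> the quasi-triangle constant is at most 2. So bound
    \<open>4 * CF\<close> is preserved: the operators shrink it to \<open>CF\<close>, and adding a
    source term of size \<open>CF\<close> returns at most \<open>4 * CF\<close>.\<close>
  have step: "weak_Lp c (4 * CF) (\<lambda>x. f x + g x)" if "weak_Lp c CF f" "weak_Lp c CF g" "c \<le> 1" for c f g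
  proof (rule weak_Lp_dominate)
    show "weak_Lp c (2 powr c * (CF + CF)) (\<lambda>x. f x + g x)"
      using that F by (intro weak_Lp_add) auto
    then show "(\<lambda>x. f x + g x) \<in> borel_measurable borel" by (rule weak_Lp_measurable)
    have "2 powr c \<le> (2::real)" using that powr_mono[of c 1 2] by simp
    then show "2 powr c * (CF + CF) \<le> 4 * CF"
      using F mult_right_mono[of "2 powr c" 2 "CF + CF"] by simp
  qed simp
  have iter: "\<exists>S1 S2 D1 D2. weak_Lp a (4 * CF) S1 \<and> weak_Lp b (4 * CF) S2
      \<and> weak_Lp a0 (C0 / 4 ^ k) D1 \<and> weak_Lp b0 (C0 / 4 ^ k) D2
      \<and> u = (\<lambda>x. S1 x + D1 x) \<and> v = (\<lambda>x. S2 x + D2 x)" for k :: nat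
  proof (induction k)
    \<comment> \<open>The induction starts after one use of the equations: the source terms are the
      first iterates, and \<open>T1 v\<close>, \<open>T2 u\<close> the first remainders.\<close>
    case 0
    have "weak_Lp a (4 * CF) F1" "weak_Lp b (4 * CF) F2"
      using F by (auto intro!: weak_Lp_mono[OF F(1)] weak_Lp_mono[OF F(2)])
    moreover have "weak_Lp a0 (C0 / 4 ^ 0) (T1 v)" "weak_Lp b0 (C0 / 4 ^ 0) (T2 u)"
      using uv(3) by (auto intro!: weak_Lp_mono[OF X1[OF uv(2,3)]] weak_Lp_mono[OF X2[OF uv(1,3)]])
    moreover have "u = (\<lambda>x. F1 x + T1 v x)" "v = (\<lambda>x. F2 x + T2 u x)"
      by (subst u, simp add: add.commute) (subst v, simp add: add.commute)
    ultimately show ?case by blast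
  next
    case (Suc k)
    then obtain S1 S2 D1 D2 where S: "weak_Lp a (4 * CF) S1" "weak_Lp b (4 * CF) S2"
      and D: "weak_Lp a0 (C0 / 4 ^ k) D1" "weak_Lp b0 (C0 / 4 ^ k) D2"
      and eq: "u = (\<lambda>x. S1 x + D1 x)" "v = (\<lambda>x. S2 x + D2 x)" by blast
    let ?S1 = "\<lambda>x. T1 S2 x + F1 x" and ?S2 = "\<lambda>x. T2 S1 x + F2 x"
    have "weak_Lp a (4 * CF) ?S1" "weak_Lp b (4 * CF) ?S2"
      using Y1[OF S(2)] Y2[OF S(1)] F ab by (auto intro!: step)
    moreover have "weak_Lp a0 (C0 / 4 ^ Suc k) (T1 D2)" "weak_Lp b0 (C0 / 4 ^ Suc k) (T2 D1)"
      using X1[OF D(2)] X2[OF D(1)] uv(3) by (simp_all add: mult.commute)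
    moreover have "u = (\<lambda>x. ?S1 x + T1 D2 x)"
    proof -
      have "T1 v = (\<lambda>x. T1 S2 x + T1 D2 x)"
        unfolding eq(2) using S D by (intro add1) (auto dest: weak_Lp_measurable)
      then show ?thesis by (subst u) (simp add: ac_simps)
    qed
    moreover have "v = (\<lambda>x. ?S2 x + T2 D1 x)"
    proof -
      have "T2 u = (\<lambda>x. T2 S1 x + T2 D1 x)"
        unfolding eq(1) using S D by (intro add2) (auto dest: weak_Lp_measurable)
      then show ?thesis by (subst v) (simp add: ac_simps)
    qed
    ultimately show ?case by blast
  qed
  have "weak_Lp a (2 * (4 * CF)) u"
    using F(3) uv(3) iter weak_Lp_measurable[OF uv(1)] by (intro weak_Lp_approximation[of _ C0 _ _ a0]) (simp, simp, simp, blast)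
  moreover have "weak_Lp b (2 * (4 * CF)) v"
    using F(3) uv(3) iter weak_Lp_measurable[OF uv(2)] by (intro weak_Lp_approximation[of _ C0 _ _ b0]) (simp, simp, simp, blast)
  ultimately show "weak_Lp a (8 * CF) u" "weak_Lp b (8 * CF) v" by simp_all
qed

text \<open>The cut-off sets exhaust the space, so dominated convergence makes the tail small in the
  strong norm, and Chebyshev transfers this. Strong integrability matters: the tail of a pure power
  such as \<open>norm x powr - (n / s)\<close>, with \<open>n\<close> the dimension, stays large in
  the weak space.\<close>

lemma in_Lp_truncation:
  fixes v :: "'a::euclidean_space \<Rightarrow> real"
  assumes Lp: "in_Lp s v" and v0: "\<And>x. v x \<ge> 0" and s: "s > 0" and \<delta>: "\<delta> > 0"
  obtains k :: nat where
    "weak_Lp (1 / s) \<delta> (\<lambda>x. ennreal (v x * indicator (- {x. norm x < real k \<and> v x \<le> real k}) x))"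
proof -
  have [measurable]: "v \<in> borel_measurable borel" using Lp by (simp add: in_Lp_def)
  have int: "integrable lborel (\<lambda>x. v x powr s)" using Lp v0 by (simp add: in_Lp_def)
  define G where "G k = {x. norm x < real k \<and> v x \<le> real k}" for k :: nat
  have [measurable]: "G k \<in> sets borel" for k unfolding G_def by measurable
  have "(\<lambda>k. \<integral>\<^sup>+x. ennreal (v x powr s * indicator (- G k) x) \<partial>lborel) \<longlonglongrightarrow> (\<integral>\<^sup>+x. 0 \<partial>(lborel :: 'a measure))"
  proof (rule nn_integral_dominated_convergence[where w = "\<lambda>x. ennreal (v x powr s)"])
    show "(\<integral>\<^sup>+x. ennreal (v x powr s) \<partial>lborel) < \<infinity>"
      using int by (simp add: integrable_iff_bounded)
    show "AE x in lborel. (\<lambda>k. ennreal (v x powr s * indicator (- G k) x)) \<longlonglongrightarrow> 0"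
    proof (rule AE_I2)
      fix x
      obtain k0 where k0: "max (norm x) (v x) < real k0" using reals_Archimedean2 by blast
      have "eventually (\<lambda>k. ennreal (v x powr s * indicator (- G k) x) = 0) sequentially"
        using eventually_ge_at_top[of k0]
        by eventually_elim (use k0 in \<open>auto simp: G_def split: split_indicator\<close>)
      then show "(\<lambda>k. ennreal (v x powr s * indicator (- G k) x)) \<longlonglongrightarrow> 0"
        by (rule tendsto_eventually)
    qed
  qed (auto intro!: AE_I2 ennreal_leI split: split_indicator)
  then have "eventually (\<lambda>k. (\<integral>\<^sup>+x. ennreal (v x powr s * indicator (- G k) x) \<partial>lborel) < ennreal (\<delta> powr s)) sequentially"
    using \<delta> by (intro order_tendstoD) auto
  then obtain k where k: "(\<integral>\<^sup>+x. ennreal (v x powr s * indicator (- G k) x) \<partial>lborel) < ennreal (\<delta> powr s)"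
    by (auto simp: eventually_sequentially)
  have "(v x * indicator (- G k) x) powr s = v x powr s * indicator (- G k) x" for x
    by (auto split: split_indicator)
  then have "weak_Lp (1 / s) \<delta> (\<lambda>x. ennreal (v x * indicator (- G k) x))"
    using k s \<delta> v0 by (intro weak_Lp_Chebyshev) (auto simp: less_imp_le)
  then show ?thesis
    using that by (simp add: G_def)
qed

section \<open>The integral system\<close>

lemma riesz_add:
  fixes f g :: "'a::euclidean_space \<Rightarrow> ennreal"
  assumes [measurable]: "f \<in> borel_measurable borel" "g \<in> borel_measurable borel"
  shows "riesz \<alpha> \<sigma> (\<lambda>x. f x + g x) = (\<lambda>x. riesz \<alpha> \<sigma> f x + riesz \<alpha> \<sigma> g x)"
  unfolding riesz_def by (simp add: distrib_left nn_integral_add)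

text \<open>The integrands agree even where the kernel or weight is singular: division by zero gives
  0, and so does a power with base 0. A negative value of \<open>f\<close> becomes 0 on both
  sides.\<close>

lemma wpot_eq_riesz:
  fixes f :: "'a::euclidean_space \<Rightarrow> real"
  shows "wpot \<alpha> \<sigma> f = riesz \<alpha> \<sigma> (\<lambda>y. ennreal (f y))"
proof -
  have "ennreal (f y / (norm (x - y) powr d * norm y powr \<sigma>))
      = ennreal (norm (x - y) powr - d) * (ennreal (norm y powr - \<sigma>) * ennreal (f y))" for x y d
  proof -
    have "f y / (norm (x - y) powr d * norm y powr \<sigma>) = norm (x - y) powr - d * (norm y powr - \<sigma> * f y)"
      by (simp add: powr_minus divide_inverse mult_ac)
    then show ?thesis
      by (simp only: ennreal_mult' powr_ge_zero)
  qed
  then show ?thesis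
    by (intro ext) (simp add: wpot_def riesz_def)
qed

lemma riesz_decomposition:
  fixes v :: "'a::euclidean_space \<Rightarrow> real"
  defines "n \<equiv> real DIM('a)"
  assumes Lp: "in_Lp (1 / e) v" and e: "e > 0" and v0: "\<And>x. v x \<ge> 0" and q: "q > 1"
    and \<alpha>: "0 < \<alpha>" "\<alpha> < n" and \<sigma>: "0 \<le> \<sigma>" "\<sigma> < \<alpha>"
    and a: "0 < a" "a < (n - \<alpha>) / n" "b + (q - 1) * e = a + (\<alpha> - \<sigma>) / n"
    and a': "0 < a'" "a' < (n - \<alpha>) / n" "b' + (q - 1) * e = a' + (\<alpha> - \<sigma>) / n"
  obtains T F CF where
    "riesz \<alpha> \<sigma> (\<lambda>y. ennreal (v y powr q)) = (\<lambda>x. T (\<lambda>y. ennreal (v y)) x + F x)"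
    "\<And>f g. f \<in> borel_measurable borel \<Longrightarrow> g \<in> borel_measurable borel \<Longrightarrow>
        T (\<lambda>x. f x + g x) = (\<lambda>x. T f x + T g x)"
    "\<And>f C. weak_Lp b C f \<Longrightarrow> C > 0 \<Longrightarrow> weak_Lp a (C / 4) (T f)"
    "\<And>f C. weak_Lp b' C f \<Longrightarrow> C > 0 \<Longrightarrow> weak_Lp a' (C / 4) (T f)"
    "CF > 0" "weak_Lp a CF F"
proof -
  have [measurable]: "v \<in> borel_measurable borel" using Lp by (simp add: in_Lp_def)
  have n: "n > 0" by (simp add: n_def)
  obtain c where c: "c > 0"
    "\<And>f C. \<lbrakk>weak_Lp (b + (q - 1) * e) C f; C > 0\<rbrakk> \<Longrightarrow> weak_Lp a (c * C) (riesz \<alpha> \<sigma> (f :: 'a \<Rightarrow> ennreal))"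
    using weak_Lp_riesz[where 'a='a, folded n_def, OF \<alpha> \<sigma>(1) a] by blast
  obtain c' where c': "c' > 0"
    "\<And>f C. \<lbrakk>weak_Lp (b' + (q - 1) * e) C f; C > 0\<rbrakk> \<Longrightarrow> weak_Lp a' (c' * C) (riesz \<alpha> \<sigma> (f :: 'a \<Rightarrow> ennreal))"
    using weak_Lp_riesz[where 'a='a, folded n_def, OF \<alpha> \<sigma>(1) a'] by blast
  \<comment> \<open>\<open>K\<close> dominates the operator constants for both exponent pairs,
    Hoelder factors included. The choice of \<open>\<delta>\<close> below then gives
    \<open>w\<close> the constant \<open>1 / (4 * K)\<close>.\<close>
  define K where "K = c * 2 powr (b + (q - 1) * e) + c' * 2 powr (b' + (q - 1) * e)"
  have K: "K > 0" using c c' by (simp add: K_def add_pos_pos)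
  define \<delta> where "\<delta> = (1 / (4 * K)) powr (1 / (q - 1))"
  have \<delta>: "\<delta> > 0" using K by (simp add: \<delta>_def)
  have \<delta>q: "\<delta> powr (q - 1) = 1 / (4 * K)"
    using K q by (simp add: \<delta>_def powr_powr)
  obtain k :: nat where k:
    "weak_Lp (1 / (1 / e)) \<delta> (\<lambda>x. ennreal (v x * indicator (- {x. norm x < real k \<and> v x \<le> real k}) x))"
    using in_Lp_truncation[OF Lp v0 _ \<delta>] e by auto
  define G where "G = {x. norm x < real k \<and> v x \<le> real k}"
  have [measurable]: "G \<in> sets borel" unfolding G_def by measurable
  define w where "w x = ennreal ((v x * indicator (- G) x) powr (q - 1))" for x
  define h where "h x = ennreal (v x powr q) * indicator G x" for x
  have [measurable]: "w \<in> borel_measurable borel" "h \<in> borel_measurable borel"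
    unfolding w_def h_def by measurable
  have "weak_Lp (e * (q - 1)) (\<delta> powr (q - 1)) w"
    unfolding w_def[abs_def] using k e \<delta> v0 q by (intro weak_Lp_powr) (auto simp: G_def)
  then have w: "weak_Lp ((q - 1) * e) (1 / (4 * K)) w"
    by (simp add: \<delta>q mult.commute)
  define T where "T f = riesz \<alpha> \<sigma> (\<lambda>y. f y * w y)" for f
  \<comment> \<open>Weak Hoelder followed by the potential estimate, stated for a generic pair so
    that it serves both.\<close>
  have contraction: "weak_Lp a2 (C / 4) (T f)"
    if f: "weak_Lp b2 C f" and C: "C > 0" and c2: "c2 > 0" "c2 * 2 powr (b2 + (q - 1) * e) \<le> K"
      and R: "\<And>f C. \<lbrakk>weak_Lp (b2 + (q - 1) * e) C f; C > 0\<rbrakk> \<Longrightarrow> weak_Lp a2 (c2 * C) (riesz \<alpha> \<sigma> (f :: 'a \<Rightarrow> ennreal))"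
    for a2 b2 c2 C f
  proof -
    have "weak_Lp (b2 + (q - 1) * e) (2 powr (b2 + (q - 1) * e) * C * (1 / (4 * K))) (\<lambda>y. f y * w y)"
      using f w C K by (intro weak_Lp_mult) auto
    then have *: "weak_Lp a2 (c2 * (2 powr (b2 + (q - 1) * e) * C * (1 / (4 * K)))) (T f)"
      unfolding T_def by (rule R) (use C K in auto)
    have "(c2 * 2 powr (b2 + (q - 1) * e)) * (C / (4 * K)) \<le> K * (C / (4 * K))"
      using c2 C K by (intro mult_right_mono) auto
    then have "c2 * (2 powr (b2 + (q - 1) * e) * C * (1 / (4 * K))) \<le> C / 4"
      using K by (simp add: mult_ac)
    with * show ?thesis
      by (rule weak_Lp_mono)
  qed
  show ?thesis
  proof (rule that)
    show "riesz \<alpha> \<sigma> (\<lambda>y. ennreal (v y powr q)) = (\<lambda>x. T (\<lambda>y. ennreal (v y)) x + riesz \<alpha> \<sigma> h x)"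
    proof -
      have "ennreal (v y powr q) = ennreal (v y) * w y + h y" for y
      proof (cases "y \<in> G")
        case False
        have "v y powr q = v y * v y powr (q - 1)"
          using v0[of y] by (cases "v y = 0") (simp_all add: powr_diff)
        then show ?thesis using False v0[of y] by (simp add: w_def h_def flip: ennreal_mult)
      qed (simp add: w_def h_def)
      then show ?thesis
        unfolding T_def by (subst riesz_add[symmetric]) simp_all
    qed
    show "T (\<lambda>x. f x + g x) = (\<lambda>x. T f x + T g x)"
      if [measurable]: "f \<in> borel_measurable borel" "g \<in> borel_measurable borel" for f g
      unfolding T_def by (subst riesz_add[symmetric]) (simp_all add: distrib_right)
    show "weak_Lp a (C / 4) (T f)" if "weak_Lp b C f" "C > 0" for f C
      using contraction[OF that c(1) _ c(2)] c'(1) by (simp add: K_def)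
    show "weak_Lp a' (C / 4) (T f)" if "weak_Lp b' C f" "C > 0" for f C
      using contraction[OF that c'(1) _ c'(2)] c(1) by (simp add: K_def)
    \<comment> \<open>Adding 1 to the height and to the volume keeps both constants positive when
      \<open>k = 0\<close>.\<close>
    define A where "A = real k + 1"
    define V where "V = unit_ball_vol n * real k ^ DIM('a) + 1"
    have V: "V > 0" using n by (simp add: V_def add_nonneg_pos)
    have A: "A > 0" by (simp add: A_def)
    have t: "b + (q - 1) * e > 0" using a \<alpha> \<sigma> n by (simp add: add_pos_pos)
    have "weak_Lp (b + (q - 1) * e) (A powr q * V powr (b + (q - 1) * e)) h"
    proof (rule weak_Lp_bounded_support)
      show "h x \<le> ennreal (A powr q)" for x
        using v0[of x] q by (auto simp: h_def G_def A_def split: split_indicator intro!: ennreal_leI powr_mono2)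
      show "h x = 0" if "x \<notin> G" for x using that by (simp add: h_def)
      have "emeasure lborel G \<le> emeasure lborel (ball 0 (real k) :: 'a set)"
        by (intro emeasure_mono) (auto simp: G_def)
      also have "\<dots> \<le> ennreal V"
        unfolding V_def n_def by (simp add: emeasure_ball)
      finally show "emeasure lborel G \<le> ennreal V" .
    qed (use V t in auto)
    then show "weak_Lp a (c * (A powr q * V powr (b + (q - 1) * e))) (riesz \<alpha> \<sigma> h)"
      using A V by (intro c(2)) auto
    show "c * (A powr q * V powr (b + (q - 1) * e)) > 0" using c A V by simp
  qed
qed

text \<open>One bootstrap step through the nonlinear equation: \<open>b\<close> is chosen so that
  the \<open>q\<close>-th power has the exponent \<open>b * q\<close> that the potential maps to
  \<open>a\<close>.\<close>

lemma weak_Lp_riesz_powr: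
  fixes v :: "'a::euclidean_space \<Rightarrow> real"
  defines "n \<equiv> real DIM('a)"
  assumes \<alpha>: "0 < \<alpha>" "\<alpha> < n" and \<sigma>: "0 \<le> \<sigma>" and a: "0 < a" "a < (n - \<alpha>) / n"
    and b: "b = (a + (\<alpha> - \<sigma>) / n) / q" and q: "q > 0"
    and v: "weak_Lp b C (\<lambda>x. ennreal (v x))" "C > 0" "\<And>x. v x \<ge> 0" "v \<in> borel_measurable borel"
  shows "\<exists>C>0. weak_Lp a C (riesz \<alpha> \<sigma> (\<lambda>y. ennreal (v y powr q)))"
proof -
  have bq: "b * q = a + (\<alpha> - \<sigma>) / n" using b q by simp
  obtain c where c: "c > 0"
    "\<And>f C. \<lbrakk>weak_Lp (b * q) C f; C > 0\<rbrakk> \<Longrightarrow> weak_Lp a (c * C) (riesz \<alpha> \<sigma> (f :: 'a \<Rightarrow> ennreal))"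
    using weak_Lp_riesz[where 'a='a, folded n_def, OF \<alpha> \<sigma> a bq] by blast
  have "weak_Lp a (c * C powr q) (riesz \<alpha> \<sigma> (\<lambda>y. ennreal (v y powr q)))"
    using v q by (intro c(2) weak_Lp_powr) auto
  then show ?thesis using c(1) v(2) by (intro exI[of _ "c * C powr q"]) auto
qed

lemma weak_Lp_solution_critical_line:
  fixes u v :: "'a::euclidean_space \<Rightarrow> real"
  defines "n \<equiv> real DIM('a)"
  assumes \<alpha>: "0 < \<alpha>" "\<alpha> < n" and \<sigma>1: "0 \<le> \<sigma>1" "\<sigma>1 < \<alpha>" and \<sigma>2: "0 \<le> \<sigma>2" "\<sigma>2 < \<alpha>"
    and pq: "p > 1" "q > 1"
    and P: "P > 0" "P \<le> Q" "Q < n - \<alpha>" and rel: "q * P = Q + (\<alpha> - \<sigma>1)" "p * Q = P + (\<alpha> - \<sigma>2)"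
    and u0: "\<And>x. u x \<ge> 0" and v0: "\<And>x. v x \<ge> 0"
    and u: "(\<lambda>x. ennreal (u x)) = riesz \<alpha> \<sigma>1 (\<lambda>y. ennreal (v y powr q))"
    and v: "(\<lambda>x. ennreal (v x)) = riesz \<alpha> \<sigma>2 (\<lambda>y. ennreal (u y powr p))"
    and uLp: "in_Lp (n / Q) u" and vLp: "in_Lp (n / P) v"
    and a: "(Q - P) / n < a" "a < (n - \<alpha>) / n"
  shows "\<exists>C>0. weak_Lp a C (\<lambda>x. ennreal (u x)) \<and> weak_Lp (a - (Q - P) / n) C (\<lambda>x. ennreal (v x))"
proof -
  have n: "n > 0" by (simp add: n_def)
  define b where "b = a - (Q - P) / n"
  have Q: "Q > 0" using P by simp
  have QP: "(Q - P) / n \<ge> 0" using P n by simp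
  have ab: "0 < a" "0 < b" "b < (n - \<alpha>) / n"
    using a QP by (auto simp: b_def)
  have lt: "Q / n < (n - \<alpha>) / n" "P / n < (n - \<alpha>) / n"
    using P n by (auto intro!: divide_strict_right_mono)
  \<comment> \<open>Exponent bookkeeping for the first operator, at the target pair and at the known
    pair; \<open>line2\<close> does the same for the second.\<close>
  have line1: "b + (q - 1) * (P / n) = a + (\<alpha> - \<sigma>1) / n" "P / n + (q - 1) * (P / n) = Q / n + (\<alpha> - \<sigma>1) / n"
  proof -
    have "q * P / n = Q / n + (\<alpha> - \<sigma>1) / n" by (simp only: rel add_divide_distrib)
    then show "b + (q - 1) * (P / n) = a + (\<alpha> - \<sigma>1) / n" "P / n + (q - 1) * (P / n) = Q / n + (\<alpha> - \<sigma>1) / n"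
      by (simp_all add: b_def algebra_simps diff_divide_distrib)
  qed
  have line2: "a + (p - 1) * (Q / n) = b + (\<alpha> - \<sigma>2) / n" "Q / n + (p - 1) * (Q / n) = P / n + (\<alpha> - \<sigma>2) / n"
  proof -
    have "p * Q / n = P / n + (\<alpha> - \<sigma>2) / n" by (simp only: rel add_divide_distrib)
    then show "a + (p - 1) * (Q / n) = b + (\<alpha> - \<sigma>2) / n" "Q / n + (p - 1) * (Q / n) = P / n + (\<alpha> - \<sigma>2) / n"
      by (simp_all add: b_def algebra_simps diff_divide_distrib)
  qed
  have Lp': "in_Lp (1 / (Q / n)) u" "in_Lp (1 / (P / n)) v" using uLp vLp by simp_all
  have pos: "0 < Q / n" "0 < P / n" using Q P n by simp_all
  obtain T1 F1 C1 where T1: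
    "riesz \<alpha> \<sigma>1 (\<lambda>y. ennreal (v y powr q)) = (\<lambda>x. T1 (\<lambda>y. ennreal (v y)) x + F1 x)"
    "\<And>f g. f \<in> borel_measurable borel \<Longrightarrow> g \<in> borel_measurable borel \<Longrightarrow>
        T1 (\<lambda>x. f x + g x) = (\<lambda>x. T1 f x + T1 g x)"
    "\<And>f C. weak_Lp b C f \<Longrightarrow> C > 0 \<Longrightarrow> weak_Lp a (C / 4) (T1 f)"
    "\<And>f C. weak_Lp (P / n) C f \<Longrightarrow> C > 0 \<Longrightarrow> weak_Lp (Q / n) (C / 4) (T1 f)"
    "C1 > 0" "weak_Lp a C1 F1"
    using riesz_decomposition[where 'a='a, folded n_def,
        OF Lp'(2) pos(2) v0 pq(2) \<alpha> \<sigma>1 ab(1) a(2) line1(1) pos(1) lt(1) line1(2)] by blast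
  obtain T2 F2 C2 where T2:
    "riesz \<alpha> \<sigma>2 (\<lambda>y. ennreal (u y powr p)) = (\<lambda>x. T2 (\<lambda>y. ennreal (u y)) x + F2 x)"
    "\<And>f g. f \<in> borel_measurable borel \<Longrightarrow> g \<in> borel_measurable borel \<Longrightarrow>
        T2 (\<lambda>x. f x + g x) = (\<lambda>x. T2 f x + T2 g x)"
    "\<And>f C. weak_Lp a C f \<Longrightarrow> C > 0 \<Longrightarrow> weak_Lp b (C / 4) (T2 f)"
    "\<And>f C. weak_Lp (Q / n) C f \<Longrightarrow> C > 0 \<Longrightarrow> weak_Lp (P / n) (C / 4) (T2 f)"
    "C2 > 0" "weak_Lp b C2 F2"
    using riesz_decomposition[where 'a='a, folded n_def,
        OF Lp'(1) pos(1) u0 pq(1) \<alpha> \<sigma>2 ab(2,3) line2(1) pos(2) lt(2) line2(2)] by blast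
  obtain C3 where C3: "C3 > 0" "weak_Lp (Q / n) C3 (\<lambda>x. ennreal (u x))"
    using in_Lp_imp_weak_Lp[OF uLp u0] Q n by auto
  obtain C4 where C4: "C4 > 0" "weak_Lp (P / n) C4 (\<lambda>x. ennreal (v x))"
    using in_Lp_imp_weak_Lp[OF vLp v0] P n by auto
  \<comment> \<open>Lifting uses one constant for both source terms and one for both
    solutions.\<close>
  define CF where "CF = max C1 C2"
  define C0 where "C0 = max C3 C4"
  have CF: "CF > 0" "weak_Lp a CF F1" "weak_Lp b CF F2"
    using T1(5) weak_Lp_mono[OF T1(6), of CF] weak_Lp_mono[OF T2(6), of CF] by (auto simp: CF_def)
  have C0: "C0 > 0" "weak_Lp (Q / n) C0 (\<lambda>x. ennreal (u x))" "weak_Lp (P / n) C0 (\<lambda>x. ennreal (v x))"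
    using C3(1) weak_Lp_mono[OF C3(2), of C0] weak_Lp_mono[OF C4(2), of C0] by (auto simp: C0_def)
  have "(n - \<alpha>) / n \<le> 1" using n \<alpha> by simp
  then have ab1: "a \<le> 1" "b \<le> 1" using a ab by auto
  note eqs = u[unfolded T1(1)] v[unfolded T2(1)]
  have "weak_Lp a (8 * CF) (\<lambda>x. ennreal (u x))" "weak_Lp b (8 * CF) (\<lambda>x. ennreal (v x))"
    using weak_Lp_regularity_lifting[OF T1(2) T2(2) T1(4) T2(4) T1(3) T2(3) CF(2,3,1) C0(2,3,1) ab1 eqs] by blast+
  then show ?thesis
    using CF(1) unfolding b_def by (intro exI[of _ "8 * CF"]) simp
qed

section \<open>Exponent arithmetic and extension beyond the critical line\<close>

theorem theorem3p2:
  fixes u v :: "real ^ 'n \<Rightarrow> real"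
    and \<alpha> \<sigma>1 \<sigma>2 p q :: real
  assumes n3: "CARD('n) \<ge> 3"
    and alpha: "0 < \<alpha>" "\<alpha> < real CARD('n)"
    and sig1: "0 \<le> \<sigma>1" "\<sigma>1 < \<alpha>"
    and sig2: "0 \<le> \<sigma>2" "\<sigma>2 < \<alpha>"
    and pq: "q \<ge> p" "p > 1"
    and sig12: "\<sigma>1 \<ge> \<sigma>2"
    and crit: "q0 \<alpha> \<sigma>1 \<sigma>2 p q + p0 \<alpha> \<sigma>1 \<sigma>2 p q \<le> real CARD('n) - \<alpha>"
    and upos: "\<And>x. u x > 0" and vpos: "\<And>x. v x > 0"
    and ueq: "\<And>x. ennreal (u x) = wpot \<alpha> \<sigma>1 (\<lambda>y. v y powr q) x"
    and veq: "\<And>x. ennreal (v x) = wpot \<alpha> \<sigma>2 (\<lambda>y. u y powr p) x"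
    and uint: "in_Lp (real CARD('n) / q0 \<alpha> \<sigma>1 \<sigma>2 p q) u"
    and vint: "in_Lp (real CARD('n) / p0 \<alpha> \<sigma>1 \<sigma>2 p q) v"
  shows "\<forall>r s. 0 < 1 / r \<and> 1 / r < (real CARD('n) - \<alpha>) / real CARD('n)
            \<and> 0 < 1 / s \<and> 1 / s < min ((real CARD('n) - \<alpha>) / real CARD('n))
                 ((p * (real CARD('n) - \<alpha>) - (\<alpha> - \<sigma>2)) / real CARD('n))
          \<longrightarrow> in_Lp r u \<and> in_Lp s v"
proof -
  define n where "n = real CARD('n)"
  have dim: "real DIM(real ^ 'n) = n" by (simp add: n_def)
  have n: "n > 0" using n3 by (simp add: n_def)
  define P where "P = p0 \<alpha> \<sigma>1 \<sigma>2 p q"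
  define Q where "Q = q0 \<alpha> \<sigma>1 \<sigma>2 p q"
  have q1: "q > 1" using pq by simp
  have pq1: "p * q - 1 > 0" using less_1_mult[OF pq(2) q1] by simp
  have "P * (p * q - 1) = \<alpha> * (1 + p) - (\<sigma>2 + \<sigma>1 * p)"
    using pq1 by (simp add: P_def p0_def)
  then have eqP: "P * (p * q - 1) = (\<alpha> - \<sigma>2) + (\<alpha> - \<sigma>1) * p"
    by (simp add: algebra_simps)
  have "Q * (p * q - 1) = \<alpha> * (1 + q) - (\<sigma>1 + \<sigma>2 * q)"
    using pq1 by (simp add: Q_def q0_def)
  then have eqQ: "Q * (p * q - 1) = (\<alpha> - \<sigma>1) + (\<alpha> - \<sigma>2) * q"
    by (simp add: algebra_simps)
  have "P * (p * q - 1) > 0"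
    unfolding eqP using sig1 sig2 pq by (intro add_pos_pos mult_pos_pos) auto
  then have P: "P > 0" using pq1 by (simp add: zero_less_mult_iff)
  \<comment> \<open>The numerators of \<open>P\<close> and \<open>Q\<close> differ by the sum of the
    two nonpositive products below.\<close>
  have "P * (p * q - 1) \<le> Q * (p * q - 1)"
  proof -
    have "(\<sigma>1 - \<sigma>2) * (1 - p) \<le> 0" "(\<alpha> - \<sigma>2) * (p - q) \<le> 0"
      using sig12 sig2 pq by (auto simp: mult_le_0_iff)
    then show ?thesis unfolding eqP eqQ by (simp add: algebra_simps)
  qed
  then have PQ: "P \<le> Q" using pq1 by simp
  \<comment> \<open>The subcriticality condition enters here: since \<open>P > 0\<close>, it leaves
    strict room above \<open>Q\<close>.\<close>
  have Qlt: "Q < n - \<alpha>" using crit P by (simp add: P_def Q_def n_def)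
  \<comment> \<open>\<open>P\<close> and \<open>Q\<close> solve the linear system
    \<open>relP\<close>, \<open>relQ\<close>; each equation is checked after multiplication by the
    positive number \<open>p * q - 1\<close>.\<close>
  have "(q * P) * (p * q - 1) = (Q + (\<alpha> - \<sigma>1)) * (p * q - 1)"
  proof -
    have "(q * P) * (p * q - 1) = q * ((\<alpha> - \<sigma>2) + (\<alpha> - \<sigma>1) * p)"
      using eqP by (simp add: mult.assoc)
    also have "\<dots> = (Q + (\<alpha> - \<sigma>1)) * (p * q - 1)"
      unfolding distrib_right eqQ by (simp add: algebra_simps)
    finally show ?thesis .
  qed
  then have relP: "q * P = Q + (\<alpha> - \<sigma>1)" using pq1 by simp
  have "(p * Q) * (p * q - 1) = (P + (\<alpha> - \<sigma>2)) * (p * q - 1)"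
  proof -
    have "(p * Q) * (p * q - 1) = p * ((\<alpha> - \<sigma>1) + (\<alpha> - \<sigma>2) * q)"
      using eqQ by (simp add: mult.assoc)
    also have "\<dots> = (P + (\<alpha> - \<sigma>2)) * (p * q - 1)"
      unfolding distrib_right eqP by (simp add: algebra_simps)
    finally show ?thesis .
  qed
  then have relQ: "p * Q = P + (\<alpha> - \<sigma>2)" using pq1 by simp
  have u0: "u x \<ge> 0" and v0: "v x \<ge> 0" for x
    using upos[of x] vpos[of x] by simp_all
  have meas [measurable]: "u \<in> borel_measurable borel" "v \<in> borel_measurable borel"
    using uint vint by (simp_all add: in_Lp_def)
  have u: "(\<lambda>x. ennreal (u x)) = riesz \<alpha> \<sigma>1 (\<lambda>y. ennreal (v y powr q))"
    and v: "(\<lambda>x. ennreal (v x)) = riesz \<alpha> \<sigma>2 (\<lambda>y. ennreal (u y powr p))"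
    using ueq veq by (simp_all add: fun_eq_iff wpot_eq_riesz)
  have alpha_n: "0 < \<alpha>" "\<alpha> < n" using alpha by (simp_all add: n_def)
  have line: "\<exists>C>0. weak_Lp a C (\<lambda>x. ennreal (u x)) \<and> weak_Lp (a - (Q - P) / n) C (\<lambda>x. ennreal (v x))"
    if "(Q - P) / n < a" "a < (n - \<alpha>) / n" for a
    using weak_Lp_solution_critical_line[where 'a="real ^ 'n", unfolded dim,
        OF alpha_n sig1 sig2 pq(2) q1 P PQ Qlt relP relQ u0 v0 u v _ _ that] uint vint
    by (simp add: P_def Q_def n_def)
  have wu: "\<exists>C>0. weak_Lp a C (\<lambda>x. ennreal (u x))" if a: "0 < a" "a < (n - \<alpha>) / n" for a
  proof (cases "(Q - P) / n < a")
    case True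
    then show ?thesis using line a by blast
  next
    case False
    \<comment> \<open>Below \<open>(Q - P) / n\<close> the line gives nothing for \<open>u\<close>,
      so the bound is pulled from \<open>v\<close> through the first equation. There
      \<open>a < Q / n\<close> forces \<open>b < P / n\<close> by \<open>relP\<close>, and such
      \<open>b\<close> are reached on the line because \<open>Q < n - \<alpha>\<close>.\<close>
    define b where "b = (a + (\<alpha> - \<sigma>1) / n) / q"
    have b0: "b > 0"
      unfolding b_def using a sig1 n q1 by (intro divide_pos_pos add_pos_pos) auto
    have "a < Q / n" using False P n by (simp add: field_simps)
    then have "b < (Q / n + (\<alpha> - \<sigma>1) / n) / q"
      unfolding b_def using q1 by (intro divide_strict_right_mono) auto
    also have "\<dots> = q * P / n / q" by (simp only: relP add_divide_distrib)
    also have "\<dots> = P / n" using q1 by simp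
    finally have "b + (Q - P) / n < P / n + (Q - P) / n" by simp
    also have "\<dots> = Q / n" by (simp flip: add_divide_distrib)
    also have "\<dots> < (n - \<alpha>) / n" using Qlt n by (intro divide_strict_right_mono) auto
    finally obtain C where C: "C > 0" "weak_Lp b C (\<lambda>x. ennreal (v x))"
      using line[of "b + (Q - P) / n"] b0 by auto
    show ?thesis
      unfolding u
      using weak_Lp_riesz_powr[where 'a="real ^ 'n", unfolded dim, OF alpha_n sig1(1) a b_def _ C(2,1) v0 meas(2)] q1
      by simp
  qed
  have wv: "\<exists>C>0. weak_Lp b C (\<lambda>x. ennreal (v x))"
    if b: "0 < b" "b < (n - \<alpha>) / n" "b < (p * (n - \<alpha>) - (\<alpha> - \<sigma>2)) / n" for b
  proof -
    \<comment> \<open>The second equation needs \<open>u\<close> at this exponent. The condition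
      \<open>a < (n - \<alpha>) / n\<close> is exactly the second bound in the minimum for
      \<open>1 / s\<close>.\<close>
    define a where "a = (b + (\<alpha> - \<sigma>2) / n) / p"
    have a0: "a > 0"
      unfolding a_def using b sig2 n pq by (intro divide_pos_pos add_pos_pos) auto
    have "a < ((p * (n - \<alpha>) - (\<alpha> - \<sigma>2)) / n + (\<alpha> - \<sigma>2) / n) / p"
      unfolding a_def using b pq by (intro divide_strict_right_mono) auto
    also have "\<dots> = (n - \<alpha>) / n"
      using pq by (simp flip: add_divide_distrib)
    finally obtain C where C: "C > 0" "weak_Lp a C (\<lambda>x. ennreal (u x))"
      using wu a0 by blast
    show ?thesis
      unfolding v
      using weak_Lp_riesz_powr[where 'a="real ^ 'n", unfolded dim, OF alpha_n sig2(1) b(1,2) a_def _ C(2,1) u0 meas(1)] pq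
      by simp
  qed
  \<comment> \<open>The range of reciprocal exponents is open, so each point has admissible weak
    exponents on both sides to interpolate between.\<close>
  have strong: "in_Lp r f"
    if meas: "f \<in> borel_measurable borel" and f0: "\<And>x. f x \<ge> 0" and r: "0 < 1 / r" "1 / r < m"
      and w: "\<And>a. 0 < a \<Longrightarrow> a < m \<Longrightarrow> \<exists>C>0. weak_Lp a C (\<lambda>x. ennreal (f x))"
    for r m and f :: "real ^ 'n \<Rightarrow> real"
  proof -
    obtain a1 where a1: "0 < a1" "a1 < 1 / r" using dense r(1) by blast
    obtain a2 where a2: "1 / r < a2" "a2 < m" using dense r(2) by blast
    obtain C1 where "C1 > 0" "weak_Lp a1 C1 (\<lambda>x. ennreal (f x))" using w[of a1] a1 r by auto
    moreover obtain C2 where "C2 > 0" "weak_Lp a2 C2 (\<lambda>x. ennreal (f x))" using w[of a2] a2 r by auto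
    ultimately show ?thesis
      using in_Lp_interpolation[OF meas f0 _ _ _ a1 _ _ a2(1)] r by simp
  qed
  show ?thesis
    unfolding n_def[symmetric]
  proof (intro allI impI conjI; elim conjE)
    fix r s assume "0 < 1 / r" "1 / r < (n - \<alpha>) / n"
    then show "in_Lp r u" using strong[OF meas(1) u0] wu by blast
  next
    fix r s assume "0 < 1 / s" "1 / s < min ((n - \<alpha>) / n) ((p * (n - \<alpha>) - (\<alpha> - \<sigma>2)) / n)"
    then show "in_Lp s v" using strong[OF meas(2) v0] wv by (metis min_less_iff_conj)
  qed
qed

end
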